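(* Let $u\in H_0^1(0,1)$ be the solution of $$b(v,u)=(f,v)\qquad\text{for all }v\in H_0^1(0,1),$$ and let $u_h\in\mathcal{M}_h$ be the solution of the upwinding Petrov-Galerkin formulation with exponential bubble test space, $$b(v_h,u_h)=(f,v_h)\qquad\text{for all }v_h\in V_h .$$ Then $$\|u-u_h\|_{*,h}\le\sqrt{\frac{h}{2\varepsilon}\,\frac{1}{g_0}}\;\inf_{p_h\in\mathcal{M}_h}\|u-p_h\|_{*,h}.$$ Equivalently, $$h^2\,|u-u_h|^2+4g_0^2\,|u-u_h|_{*,h}^2\le\frac{h}{2\varepsilon}\,\frac{1}{g_0}\inf_{p_h\in\mathcal{M}_h}\left(h^2\,|u-p_h|^2+4g_0^2\,|u-p_h|_{*,h}^2\right).$$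
   Context: Let $\varepsilon>0$, let $f$ be a continuous function on $[0,1]$, let $n\ge 2$ be an integer, $h=1/n$, and $x_j=jh$ for $j=0,\dots,n$. Here $(f,v)=\int_0^1 fv\,dx$, $b(v,u)=\varepsilon\int_0^1 u'v'\,dx+\int_0^1 u'v\,dx$ for $u,v\in H_0^1(0,1)$, $|u|^2=\int_0^1 (u'(x))^2\,dx$, and $$g_0:=\tanh\left(\frac{h}{2\varepsilon}\right).$$ Trial space: $\mathcal{M}_h=\mathrm{span}\{\varphi_j\}_{j=1}^{n-1}$ is the space of continuous functions on $[0,1]$ that are linear on each $[x_{j-1},x_j]$ and vanish at $0$ and $1$; $\varphi_j$ are the nodal basis functions, $\varphi_j(x_i)=\delta_{ij}$. Exponential bubble test space: let $B$ be the solution on $[0,h]$ of $-\varepsilon B''-B'=1/h$, $B(0)=B(h)=0$, i.e. $B(x)=\frac{1+g_0}{2g_0}\left(1-e^{-x/\varepsilon}\right)-\frac{x}{h}$. For $i=1,\dots,n$ let $B_i(x)=B(x-x_{i-1})$ on $[x_{i-1},x_i]$ and $B_i=0$ on the rest of $[0,1]$. Then $V_h=\mathrm{span}\{\varphi_j+(B_j-B_{j+1})\}_{j=1}^{n-1}\subset H_0^1(0,1)$. The discrete optimal trial norm, considered on all of $H_0^1(0,1)$, is given by $$\|u\|_{*,h}^2=2g_0\,\frac{\varepsilon}{h}\left(\frac{h^2}{4g_0^2}|u|^2+|u|_{*,h}^2\right),$$ where $$|u|_{*,h}^2:=\frac1n\sum_{i=1}^n\left(\frac1h\int_{x_{i-1}}^{x_i}u(x)\,dx\right)^2-\left(\int_0^1u(x)\,dx\right)^2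 .$$ *)

theory Defs
  imports "HOL-Analysis.Analysis"
begin

section \<open>Lebesgue and Sobolev spaces on the unit interval\<close>

text \<open>
  Elements of the function spaces are represented by functions of type \<^typ>\<open>real \<Rightarrow> real\<close>; only
  their values on the unit interval, up to null sets, are relevant.
\<close>

definition leb_int :: "real \<Rightarrow> real \<Rightarrow> (real \<Rightarrow> real) \<Rightarrow> real" where
  "leb_int a b f = (LINT x|lebesgue_on {a..b}. f x)"

definition L2 :: "(real \<Rightarrow> real) set" where
  "L2 = {u. u \<in> borel_measurable (lebesgue_on {0..1}) \<and>
            integrable (lebesgue_on {0..1}) (\<lambda>x. (u x)\<^sup>2)}"

definition L2_inner :: "(real \<Rightarrow> real) \<Rightarrow> (real \<Rightarrow> real) \<Rightarrow> real" where
  "L2_inner f v = leb_int 0 1 (\<lambda>x. f x * v x)"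

definition C1c :: "(real \<Rightarrow> real) set" where
  "C1c = {\<phi>. \<phi> C1_differentiable_on UNIV \<and> compact (closure {x. \<phi> x \<noteq> 0}) \<and>
             closure {x. \<phi> x \<noteq> 0} \<subseteq> {0<..<1}}"

definition is_weak_deriv :: "(real \<Rightarrow> real) \<Rightarrow> (real \<Rightarrow> real) \<Rightarrow> bool" where
  "is_weak_deriv u g \<longleftrightarrow>
     g \<in> L2 \<and> (\<forall>\<phi>\<in>C1c. leb_int 0 1 (\<lambda>x. u x * deriv \<phi> x) = - leb_int 0 1 (\<lambda>x. g x * \<phi> x))"

definition H1 :: "(real \<Rightarrow> real) set" where
  "H1 = {u \<in> L2. \<exists>g. is_weak_deriv u g}"

text \<open>
  A representative of the weak derivative, which is unique up to null sets in \<open>(0,1)\<close>.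
  Nothing is specified when \<open>u\<close> is not in \<^const>\<open>H1\<close>.
\<close>

definition wderiv :: "(real \<Rightarrow> real) \<Rightarrow> real \<Rightarrow> real" where
  "wderiv u = (SOME g. is_weak_deriv u g)"

definition H1_norm :: "(real \<Rightarrow> real) \<Rightarrow> real" where
  "H1_norm u = sqrt (leb_int 0 1 (\<lambda>x. (u x)\<^sup>2) + leb_int 0 1 (\<lambda>x. (wderiv u x)\<^sup>2))"

text \<open>
  The space \<open>H\<^sub>0\<^sup>1(0,1)\<close> is the closure in \<^const>\<open>H1\<close> of the compactly supported \<open>C\<^sup>1\<close>
  functions, as in Brezis, Functional Analysis, Sobolev Spaces and Partial Differential
  Equations, Chapter 8; smooth test functions give the same spaces.
\<close>

definition H10 :: "(real \<Rightarrow> real) set" where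
  "H10 = {u \<in> H1. \<forall>e>0. \<exists>\<phi>\<in>C1c. H1_norm (\<lambda>x. u x - \<phi> x) < e}"

definition H10_norm_sq :: "(real \<Rightarrow> real) \<Rightarrow> real" where
  "H10_norm_sq u = leb_int 0 1 (\<lambda>x. (wderiv u x)\<^sup>2)"

text \<open>The first argument is the test function.\<close>

definition bform :: "real \<Rightarrow> (real \<Rightarrow> real) \<Rightarrow> (real \<Rightarrow> real) \<Rightarrow> real" where
  "bform \<epsilon> v u =
     \<epsilon> * leb_int 0 1 (\<lambda>x. wderiv u x * wderiv v x) + leb_int 0 1 (\<lambda>x. wderiv u x * v x)"


section \<open>Discrete spaces\<close>

definition mesh_size :: "nat \<Rightarrow> real" where
  "mesh_size n = 1 / real n"

definition node :: "nat \<Rightarrow> nat \<Rightarrow> real" where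
  "node n j = real j * mesh_size n"

definition g0 :: "real \<Rightarrow> nat \<Rightarrow> real" where
  "g0 \<epsilon> n = tanh (mesh_size n / (2 * \<epsilon>))"

text \<open>The closed form of the nodal basis function of node \<open>j\<close>, cf. the two lemmas below.\<close>

definition hat :: "nat \<Rightarrow> nat \<Rightarrow> real \<Rightarrow> real" where
  "hat n j x = max 0 (1 - \<bar>x - node n j\<bar> / mesh_size n)"

lemma hat_nodal:
  assumes "n \<ge> 2"
  shows "hat n j (node n i) = (if i = j then 1 else 0)"
proof -
  have h: "mesh_size n > 0" using assms by (simp add: mesh_size_def)
  have "node n i - node n j = (real i - real j) * mesh_size n"
    by (simp add: node_def algebra_simps)
  then have "\<bar>node n i - node n j\<bar> / mesh_size n = \<bar>real i - real j\<bar>"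
    using h by (simp add: abs_mult)
  moreover have "i \<noteq> j \<Longrightarrow> \<bar>real i - real j\<bar> \<ge> 1" by linarith
  ultimately show ?thesis by (auto simp: hat_def)
qed

lemma hat_piecewise_linear:
  assumes "n \<ge> 2"
  shows "\<exists>a b. \<forall>x\<in>{node n i..node n (Suc i)}. hat n j x = a * x + b"
proof -
  define h where "h = mesh_size n"
  have h: "h > 0" using assms by (simp add: mesh_size_def h_def)
  have eq: "node n k = real k * h" for k by (simp add: node_def h_def)
  consider "Suc i < j" | "Suc i = j" | "i = j" | "i > j" by linarith
  then show ?thesis
  proof cases
    case 1
    then have "real (Suc i) * h \<le> (real j - 1) * h" using h by (intro mult_right_mono) auto
    then have "\<forall>x\<in>{node n i..node n (Suc i)}. hat n j x = 0 * x + 0"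
      using h by (auto simp: hat_def eq h_def[symmetric] field_simps abs_if)
    then show ?thesis by blast
  next
    case 2
    then have "\<forall>x\<in>{node n i..node n (Suc i)}. hat n j x = (1 / h) * x + (1 - real j)"
      using h by (auto simp: hat_def eq h_def[symmetric] field_simps abs_if)
    then show ?thesis by blast
  next
    case 3
    then have "\<forall>x\<in>{node n i..node n (Suc i)}. hat n j x = (- 1 / h) * x + (1 + real j)"
      using h by (auto simp: hat_def eq h_def[symmetric] field_simps abs_if)
    then show ?thesis by blast
  next
    case 4
    then have "(real j + 1) * h \<le> real i * h" using h by (intro mult_right_mono) auto
    then have "\<forall>x\<in>{node n i..node n (Suc i)}. hat n j x = 0 * x + 0"
      using h by (auto simp: hat_def eq h_def[symmetric] field_simps abs_if)
    then show ?thesis by blast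
  qed
qed

definition trial_space :: "nat \<Rightarrow> (real \<Rightarrow> real) set" where
  "trial_space n = {p. \<exists>c. p = (\<lambda>x. \<Sum>j=1..n-1. c j * hat n j x)}"

definition bubble :: "real \<Rightarrow> nat \<Rightarrow> real \<Rightarrow> real" where
  "bubble \<epsilon> n x =
     (1 + g0 \<epsilon> n) / (2 * g0 \<epsilon> n) * (1 - exp (- x / \<epsilon>)) - x / mesh_size n"

lemma bubble_boundary_value_problem:
  assumes "\<epsilon> > 0" "n \<ge> 2"
  shows "bubble \<epsilon> n 0 = 0" "bubble \<epsilon> n (mesh_size n) = 0"
    and "- \<epsilon> * deriv (deriv (bubble \<epsilon> n)) x - deriv (bubble \<epsilon> n) x = 1 / mesh_size n"
proof -
  define h where "h = mesh_size n"
  define A where "A = (1 + g0 \<epsilon> n) / (2 * g0 \<epsilon> n)"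
  have h: "h > 0" using assms by (simp add: mesh_size_def h_def)
  have B: "bubble \<epsilon> n = (\<lambda>x. A * (1 - exp (- x / \<epsilon>)) - x / h)"
    by (simp add: fun_eq_iff bubble_def A_def h_def)
  show "bubble \<epsilon> n 0 = 0" by (simp add: B)
  define q where "q = exp (- h / \<epsilon>)"
  have q: "0 < q" "q < 1" using h assms by (auto simp: q_def)
  have g: "g0 \<epsilon> n = (1 - q) / (1 + q)"
    by (simp add: g0_def h_def[symmetric] tanh_real_altdef q_def)
  have "1 + g0 \<epsilon> n = 2 / (1 + q)" "2 * g0 \<epsilon> n = 2 * (1 - q) / (1 + q)"
    using q by (simp_all add: g field_simps)
  then have "A = (2 / (1 + q)) / (2 * (1 - q) / (1 + q))" by (simp only: A_def)
  moreover have "(2 / r) / (2 * s / r) = 1 / s" if "r \<noteq> 0" for r s :: real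
    using that by simp
  ultimately have "A = 1 / (1 - q)" using q by (metis add_pos_pos less_irrefl zero_less_one)
  then show "bubble \<epsilon> n (mesh_size n) = 0"
    using q h assms by (simp add: B h_def[symmetric] q_def)
  have "(bubble \<epsilon> n has_field_derivative A / \<epsilon> * exp (- x / \<epsilon>) - 1 / h) (at x)" for x
    unfolding B using assms h by (auto intro!: derivative_eq_intros simp: field_simps)
  then have d: "deriv (bubble \<epsilon> n) = (\<lambda>x. A / \<epsilon> * exp (- x / \<epsilon>) - 1 / h)"
    by (auto intro!: ext DERIV_imp_deriv)
  have "((\<lambda>x. A / \<epsilon> * exp (- x / \<epsilon>) - 1 / h) has_field_derivative
         - (A / \<epsilon>\<^sup>2 * exp (- x / \<epsilon>))) (at x)"
    using assms h by (auto intro!: derivative_eq_intros simp: field_simps power2_eq_square)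
  then have "deriv (deriv (bubble \<epsilon> n)) x = - (A / \<epsilon>\<^sup>2 * exp (- x / \<epsilon>))"
    unfolding d by (rule DERIV_imp_deriv)
  then show "- \<epsilon> * deriv (deriv (bubble \<epsilon> n)) x - deriv (bubble \<epsilon> n) x = 1 / mesh_size n"
    using assms by (simp add: d h_def[symmetric] power2_eq_square)
qed

definition elem_bubble :: "real \<Rightarrow> nat \<Rightarrow> nat \<Rightarrow> real \<Rightarrow> real" where
  "elem_bubble \<epsilon> n i x =
     (if x \<in> {node n (i - 1)..node n i} then bubble \<epsilon> n (x - node n (i - 1)) else 0)"

definition test_space :: "real \<Rightarrow> nat \<Rightarrow> (real \<Rightarrow> real) set" where
  "test_space \<epsilon> n = {v. \<exists>c. v = (\<lambda>x. \<Sum>j=1..n-1.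
     c j * (hat n j x + (elem_bubble \<epsilon> n j x - elem_bubble \<epsilon> n (j + 1) x)))}"


section \<open>The discrete optimal trial norm\<close>

definition star_seminorm_sq :: "nat \<Rightarrow> (real \<Rightarrow> real) \<Rightarrow> real" where
  "star_seminorm_sq n u =
     1 / real n * (\<Sum>i=1..n. (1 / mesh_size n * leb_int (node n (i - 1)) (node n i) u)\<^sup>2)
       - (leb_int 0 1 u)\<^sup>2"

definition star_norm :: "real \<Rightarrow> nat \<Rightarrow> (real \<Rightarrow> real) \<Rightarrow> real" where
  "star_norm \<epsilon> n u =
     sqrt (2 * g0 \<epsilon> n * (\<epsilon> / mesh_size n) *
           ((mesh_size n)\<^sup>2 / (4 * (g0 \<epsilon> n)\<^sup>2) * H10_norm_sq u + star_seminorm_sq n u))"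

end

theory Submission
  imports Defs "HOL-Real_Asymp.Real_Asymp"
begin

text \<open>
  On every cell of the mesh the test functions solve the homogeneous adjoint equation
  \<open>(\<epsilon> v' + v)' = 0\<close>; this is what the exponential bubble is made for. Therefore the bilinear form,
  which is the integral of \<open>u' (\<epsilon> v' + v)\<close>, sees \<open>u\<close> only through its increments over the cells.
  For the error \<open>e = u - u\<^sub>h\<close>, testing with the basis functions gives a two-term recurrence with
  positive ratio for these increments. Their sum is \<open>e(1) - e(0) = 0\<close>, so they all vanish
  (\<open>recurrence_mean_zero_imp_zero\<close>, \<open>Petrov_Galerkin_error_increments\<close>): the discrete solution is
  the nodal interpolant of \<open>u\<close>.

  Two estimates follow. The function \<open>e'\<close> is orthogonal to the piecewise constant functions, among
  them the derivatives of the trial functions, so \<open>|e| \<le> |u - p|\<close> for every trial function \<open>p\<close>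
  (\<open>error_energy_minimal\<close>). The integral of \<open>e\<close> over a cell is the integral of \<open>e'\<close> against the
  linear function \<open>m - x\<close> with \<open>m\<close> the midpoint, and Cauchy--Schwarz bounds the squared seminorm of
  cell means by \<open>h\<^sup>2/12 |e|\<^sup>2\<close> (\<open>star_seminorm_sq_bound\<close>). With \<open>g = g\<^sub>0\<close>, the scaled squared norm of
  \<open>e\<close> is thus at most \<open>(1 + g\<^sup>2/3) h\<^sup>2 |u - p|\<^sup>2\<close>. Put \<open>t = h/(2\<epsilon>)\<close>, so that \<open>g = tanh t\<close>. The elementary
  inequality \<open>1 + g\<^sup>2/3 \<le> t/g\<close> (\<open>tanh_cubic_le\<close>) produces the constant of the theorem, and the
  seminorm of cell means of \<open>u - p\<close> can be added on the right because it is nonnegative.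

  Making this rigorous for weak derivatives needs two tools. Bounded measurable functions are limits
  of test functions (\<open>C1c_approximation\<close>); this gives the uniqueness of weak derivatives and
  places the continuous, piecewise smooth functions that vanish at the end points in
  \<open>H\<^sub>0\<^sup>1(0,1)\<close> (\<open>H10_graph_piecewise\<close>). And a linear identity between a function and its
  derivative passes from test functions to all of \<open>H\<^sub>0\<^sup>1(0,1)\<close> by continuity in \<open>L\<^sup>2\<close>
  (\<open>H10_graph_extend\<close>); this yields the formulas for integrals over cells without absolutely
  continuous representatives.
\<close>

section \<open>Square-integrable functions\<close>

abbreviation unit_leb :: "real measure" where
  "unit_leb \<equiv> lebesgue_on {0..1}"

lemma L2D: "f \<in> L2 \<Longrightarrow> f \<in> borel_measurable unit_leb" "f \<in> L2 \<Longrightarrow> integrable unit_leb (\<lambda>x. (f x)\<^sup>2)"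
  by (simp_all add: L2_def)

lemma integrable_mult_L2:
  assumes "f \<in> L2" "g \<in> L2" shows "integrable unit_leb (\<lambda>x. f x * g x)"
proof (rule Bochner_Integration.integrable_bound)
  show "integrable unit_leb (\<lambda>x. (f x)\<^sup>2 + (g x)\<^sup>2)" using assms by (simp add: L2_def)
  show "(\<lambda>x. f x * g x) \<in> borel_measurable unit_leb" using assms by (auto simp: L2_def)
  have "\<bar>a * b\<bar> \<le> a\<^sup>2 + b\<^sup>2" for a b :: real
  proof -
    have "2 * (\<bar>a\<bar> * \<bar>b\<bar>) \<le> a\<^sup>2 + b\<^sup>2" using sum_squares_bound[of "\<bar>a\<bar>" "\<bar>b\<bar>"] by (simp add: mult.assoc)
    moreover have "0 \<le> \<bar>a\<bar> * \<bar>b\<bar>" by simp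
    ultimately show ?thesis unfolding abs_mult by linarith
  qed
  then show "AE x in unit_leb. norm (f x * g x) \<le> norm ((f x)\<^sup>2 + (g x)\<^sup>2)" by simp
qed

lemma L2_add: "f \<in> L2 \<Longrightarrow> g \<in> L2 \<Longrightarrow> (\<lambda>x. f x + g x) \<in> L2"
  using integrable_mult_L2[of f g] by (auto simp: L2_def power2_sum mult.assoc)

lemma L2_scale: "f \<in> L2 \<Longrightarrow> (\<lambda>x. c * f x) \<in> L2"
  by (auto simp: L2_def power_mult_distrib)

lemma L2_diff: "f \<in> L2 \<Longrightarrow> g \<in> L2 \<Longrightarrow> (\<lambda>x. f x - g x) \<in> L2"
  using L2_add[of f "\<lambda>x. -1 * g x"] L2_scale[of g "-1"] by simp

lemma L2_bounded:
  assumes "f \<in> borel_measurable unit_leb" "\<And>x. x \<in> {0..1} \<Longrightarrow> \<bar>f x\<bar> \<le> M"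
  shows "f \<in> L2"
proof -
  have "integrable unit_leb (\<lambda>x. (f x)\<^sup>2)"
  proof (rule Bochner_Integration.integrable_bound)
    show "integrable unit_leb (\<lambda>x. M\<^sup>2)" by simp
    have "(f x)\<^sup>2 \<le> M\<^sup>2" if "x \<in> {0..1}" for x
      using power_mono[OF assms(2)[OF that], of 2] by simp
    then show "AE x in unit_leb. norm ((f x)\<^sup>2) \<le> norm (M\<^sup>2)" by (auto intro!: AE_I2)
  qed (use assms in auto)
  then show ?thesis using assms by (simp add: L2_def)
qed

lemma indicator_L2: "indicator {a..b} \<in> L2"
proof (rule L2_bounded[where M = 1])
  show "indicator {a..b} \<in> borel_measurable unit_leb"
    by (intro measurable_restrict_space1 borel_measurable_indicator) simp
qed (auto simp: indicator_def)

lemma L2_continuous: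
  assumes "continuous_on {0..1} f" shows "f \<in> L2"
proof -
  have "bounded (f ` {0..1})" using assms by (intro compact_imp_bounded compact_continuous_image) auto
  then obtain M where "\<forall>x\<in>{0..1}. \<bar>f x\<bar> \<le> M" by (auto simp: bounded_iff)
  then have "\<And>x. x \<in> {0..1} \<Longrightarrow> \<bar>f x\<bar> \<le> M" by blast
  moreover have "f \<in> borel_measurable unit_leb"
    using assms by (intro continuous_imp_measurable_on_sets_lebesgue) auto
  ultimately show ?thesis by (rule L2_bounded[rotated])
qed

lemma L2_const: "(\<lambda>x. c) \<in> L2" by (intro L2_continuous continuous_intros)

lemma L2_integrable: "f \<in> L2 \<Longrightarrow> integrable unit_leb f"
  using integrable_mult_L2[OF _ L2_const[of 1]] by simp

lemma integral_Cauchy_Schwarz: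
  fixes f g :: "'a \<Rightarrow> real"
  assumes "integrable M (\<lambda>x. (f x)\<^sup>2)" "integrable M (\<lambda>x. (g x)\<^sup>2)" "integrable M (\<lambda>x. f x * g x)"
  shows "(LINT x|M. f x * g x)\<^sup>2 \<le> (LINT x|M. (f x)\<^sup>2) * (LINT x|M. (g x)\<^sup>2)"
proof -
  define A B C where "A = (LINT x|M. (f x)\<^sup>2)" and "B = (LINT x|M. (g x)\<^sup>2)" and "C = (LINT x|M. f x * g x)"
  have q: "0 \<le> s\<^sup>2 * A - 2 * s * t * C + t\<^sup>2 * B" for s t
  proof -
    have "0 \<le> (LINT x|M. (s * f x - t * g x)\<^sup>2)" by simp
    also have "(\<lambda>x. (s * f x - t * g x)\<^sup>2) = (\<lambda>x. s\<^sup>2 * (f x)\<^sup>2 - 2 * s * t * (f x * g x) + t\<^sup>2 * (g x)\<^sup>2)"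
      by (simp add: fun_eq_iff power2_eq_square algebra_simps)
    finally show ?thesis using assms by (simp add: A_def B_def C_def)
  qed
  have B: "0 \<le> B" by (simp add: B_def)
  have "C\<^sup>2 \<le> A * B"
  proof (cases "B = 0")
    case True
    have "C = 0"
    proof (rule ccontr)
      assume "C \<noteq> 0"
      \<comment> \<open>The form is linear in \<open>t\<close> if \<open>B = 0\<close>; this \<open>t\<close> gives the value \<open>- 1\<close>.\<close>
      then show False using q[of 1 "(A + 1) / (2 * C)"] True by simp
    qed
    then show ?thesis using True by simp
  next
    case False
    have "0 \<le> B * (A * B - C\<^sup>2)" using q[of B C] by (simp add: power2_eq_square algebra_simps)
    then show ?thesis using B False by (simp add: zero_le_mult_iff)
  qed
  then show ?thesis by (simp add: A_def B_def C_def)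
qed

lemma L2_Cauchy_Schwarz:
  assumes "f \<in> L2" "g \<in> L2"
  shows "\<bar>leb_int 0 1 (\<lambda>x. f x * g x)\<bar>
    \<le> sqrt (leb_int 0 1 (\<lambda>x. (f x)\<^sup>2)) * sqrt (leb_int 0 1 (\<lambda>x. (g x)\<^sup>2))"
  using integral_Cauchy_Schwarz[of unit_leb f g] assms integrable_mult_L2[OF assms]
  by (simp add: leb_int_def L2D real_sqrt_mult[symmetric] real_le_rsqrt flip: real_sqrt_abs)

section \<open>Density of the test functions\<close>

lemma C1_differentiable_on_UNIV_I:
  fixes f :: "real \<Rightarrow> real"
  assumes "\<And>x. (f has_real_derivative D x) (at x)" "continuous_on UNIV D"
  shows "f C1_differentiable_on UNIV"
  unfolding C1_differentiable_on_def
  by (rule exI[of _ D]) (use assms in \<open>auto simp: has_real_derivative_iff_has_vector_derivative\<close>)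

text \<open>A cut-off function that is continuously differentiable because \<open>(max 0 s)\<^sup>2\<close> is.\<close>

definition cutoff :: "nat \<Rightarrow> real \<Rightarrow> real" where
  "cutoff k x = (max 0 (real k * (x * (1 - x)) - 1))\<^sup>2 / (1 + (max 0 (real k * (x * (1 - x)) - 1))\<^sup>2)"

lemma C1_cutoff: "cutoff k C1_differentiable_on UNIV"
proof -
  have m: "((\<lambda>s. (max 0 s)\<^sup>2) has_real_derivative 2 * max 0 s) (at s)" for s :: real
  proof -
    consider "s < 0" | "s > 0" | "s = 0" by linarith
    then show ?thesis
    proof cases
      case 1
      have "((\<lambda>s. 0) has_real_derivative 2 * max 0 s) (at s)" using 1 by simp
      then show ?thesis
        by (rule has_field_derivative_transform_within_open[where S = "{..<0}"]) (use 1 in auto)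
    next
      case 2
      have "((\<lambda>s. s\<^sup>2) has_real_derivative 2 * max 0 s) (at s)"
        using 2 by (auto intro!: derivative_eq_intros)
      then show ?thesis
        by (rule has_field_derivative_transform_within_open[where S = "{0<..}"]) (use 2 in auto)
    next
      case 3
      have "((\<lambda>y. ((max 0 y)\<^sup>2 - (max 0 0)\<^sup>2) / (y - 0)) \<longlongrightarrow> 0) (at (0::real))"
      proof (rule Lim_null_comparison)
        have "norm (((max 0 y)\<^sup>2 - (max 0 0)\<^sup>2) / (y - 0)) \<le> \<bar>y\<bar>" for y :: real
          by (cases "y < 0") (auto simp: max_def power2_eq_square)
        then show "\<forall>\<^sub>F y in at 0. norm (((max 0 y)\<^sup>2 - (max 0 0)\<^sup>2) / (y - 0)) \<le> \<bar>y::real\<bar>"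
          by simp
        show "((\<lambda>y. \<bar>y\<bar>) \<longlongrightarrow> 0) (at (0::real))" by (intro tendsto_eq_intros) auto
      qed
      then show ?thesis using 3 by (simp add: has_field_derivative_iff)
    qed
  qed
  define P where "P = (\<lambda>x. real k * (x * (1 - x)) - 1)"
  have P: "((\<lambda>x. (max 0 (P x))\<^sup>2) has_real_derivative 2 * max 0 (P x) * (real k * (1 - 2 * x))) (at x)" for x
    by (rule DERIV_chain2[OF m]) (auto simp: P_def intro!: derivative_eq_intros simp: algebra_simps)
  have nz: "1 + (max 0 (P x))\<^sup>2 \<noteq> 0" for x by (metis add_pos_nonneg less_irrefl zero_le_power2 zero_less_one)
  have quot: "((\<lambda>x. Q x / (1 + Q x)) has_real_derivative D / (1 + Q x)\<^sup>2) (at x)"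
    if "(Q has_real_derivative D) (at x)" "1 + Q x \<noteq> 0" for Q D and x :: real
    using that by (auto intro!: derivative_eq_intros simp: power2_eq_square algebra_simps)
  have "(cutoff k has_real_derivative 2 * max 0 (P x) * (real k * (1 - 2 * x)) / (1 + (max 0 (P x))\<^sup>2)\<^sup>2) (at x)" for x
    using quot[OF P nz] by (simp add: cutoff_def[abs_def] P_def)
  moreover have "continuous_on UNIV (\<lambda>x. 2 * max 0 (P x) * (real k * (1 - 2 * x)) / (1 + (max 0 (P x))\<^sup>2)\<^sup>2)"
    unfolding P_def by (intro continuous_intros) (use nz in \<open>auto simp: P_def\<close>)
  ultimately show ?thesis by (rule C1_differentiable_on_UNIV_I)
qed

lemma cutoff_bounds: "0 \<le> cutoff k x" "cutoff k x \<le> 1"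
  by (simp_all add: cutoff_def divide_le_eq add_pos_nonneg)

lemma cutoff_tendsto_1:
  assumes "0 < x" "x < 1" shows "(\<lambda>k. cutoff k x) \<longlonglongrightarrow> 1"
proof -
  define c where "c = x * (1 - x)"
  have c: "c > 0" using assms by (simp add: c_def)
  have "filterlim (\<lambda>k. real k * c - 1) at_top sequentially"
    using c by real_asymp
  moreover have "((\<lambda>s::real. (max 0 s)\<^sup>2 / (1 + (max 0 s)\<^sup>2)) \<longlongrightarrow> 1) at_top"
  proof (rule Lim_transform_eventually)
    show "((\<lambda>s::real. s\<^sup>2 / (1 + s\<^sup>2)) \<longlongrightarrow> 1) at_top" by real_asymp
    show "\<forall>\<^sub>F s in at_top. s\<^sup>2 / (1 + s\<^sup>2) = (max 0 s)\<^sup>2 / (1 + (max 0 s)\<^sup>2 :: real)"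
      using eventually_ge_at_top[of 0] by eventually_elim simp
  qed
  ultimately show ?thesis
    unfolding cutoff_def c_def[symmetric] by (rule filterlim_compose[rotated])
qed

lemma cutoff_mult_C1c:
  assumes "p C1_differentiable_on UNIV" shows "(\<lambda>x. p x * cutoff k x) \<in> C1c"
proof -
  define T where "T = {x. real k * (x * (1 - x)) \<ge> 1}"
  have T: "closed T" unfolding T_def by (intro closed_Collect_le continuous_intros)
  have T01: "T \<subseteq> {0<..<1}"
  proof
    fix x assume "x \<in> T"
    then have "0 < x * (1 - x)"
      unfolding T_def by (smt (verit) mem_Collect_eq mult_nonneg_nonpos of_nat_0_le_iff)
    then show "x \<in> {0<..<1}" by (auto simp: zero_less_mult_iff)
  qed
  then have "bounded T" by (rule bounded_subset[rotated]) (auto intro: bounded_subset[OF bounded_closed_interval])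
  moreover have sub: "closure {x. p x * cutoff k x \<noteq> 0} \<subseteq> T"
    by (rule closure_minimal[OF _ T]) (auto simp: cutoff_def T_def max_def split: if_splits)
  ultimately have "compact (closure {x. p x * cutoff k x \<noteq> 0})"
    by (meson bounded_subset closed_closure compact_eq_bounded_closed)
  moreover have "(\<lambda>x. p x * cutoff k x) C1_differentiable_on UNIV"
    using assms C1_cutoff[of k] by (intro C1_differentiable_on_mult) auto
  ultimately show ?thesis using sub T01 by (auto simp: C1c_def)
qed

lemma AE_unit_leb_not_in:
  assumes "negligible N" shows "AE x in unit_leb. x \<notin> N"
proof (rule AE_restrict_space_iff[THEN iffD2])
  have "N \<in> null_sets lebesgue" using assms by (simp add: negligible_iff_null_sets[symmetric])
  then show "AE x in lebesgue. x \<in> {0..1} \<longrightarrow> x \<notin> N" using AE_not_in by fastforce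
qed auto

text \<open>
  A measurable function is almost everywhere the limit of continuous functions. These are truncated
  at \<open>\<plusminus>M\<close>, replaced by polynomials with Weierstrass' theorem (whence \<open>M + 1\<close>), and cut off.
\<close>

lemma C1c_approximation:
  assumes g: "g \<in> borel_measurable unit_leb" and M: "\<And>x. x \<in> {0..1} \<Longrightarrow> \<bar>g x\<bar> \<le> M"
  obtains \<phi> where "\<And>k. \<phi> k \<in> C1c" "\<And>k x. x \<in> {0..1} \<Longrightarrow> \<bar>\<phi> k x\<bar> \<le> M + 1"
    "AE x in unit_leb. (\<lambda>k. \<phi> k x) \<longlonglongrightarrow> g x"
proof -
  have "(\<lambda>x. if x \<in> {0..1} then g x else 0) \<in> borel_measurable lebesgue"
    using g by (subst borel_measurable_if) auto
  then have "(\<lambda>x. if x \<in> {0..1} then g x else 0) measurable_on UNIV"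
    by (rule lebesgue_measurable_imp_measurable_on) auto
  then obtain N G where N: "negligible N" and G: "\<And>k. continuous_on UNIV (G k)"
    and lim: "\<And>x. x \<notin> N \<Longrightarrow> (\<lambda>k. G k x) \<longlonglongrightarrow> (if x \<in> {0..1} then g x else 0)"
    unfolding measurable_on_def by auto
  define H where "H k x = max (-M) (min M (G k x))" for k x
  have contH: "continuous_on {0..1} (H k)" for k
    unfolding H_def by (intro continuous_intros continuous_on_subset[OF G]) auto
  have "\<exists>p. real_polynomial_function p \<and> (\<forall>x\<in>{0..1}. \<bar>H k x - p x\<bar> < inverse (real (Suc k)))" for k
    using Stone_Weierstrass_real_polynomial_function[OF compact_Icc contH[of k], of "inverse (real (Suc k))"]
    by (metis inverse_positive_iff_positive of_nat_0_less_iff zero_less_Suc)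
  then obtain p where p: "\<And>k. real_polynomial_function (p k)"
    and pH: "\<And>k x. x \<in> {0..1} \<Longrightarrow> \<bar>H k x - p k x\<bar> < inverse (real (Suc k))" by metis
  have M0: "0 \<le> M" using M[of 0] by simp
  have c1: "p k C1_differentiable_on UNIV" for k
  proof -
    obtain p' where p': "real_polynomial_function p'"
      "\<And>x. (p k has_real_derivative p' x) (at x)"
      using has_real_derivative_polynomial_function p real_polynomial_function_eq by metis
    have "continuous_on UNIV p'"
      using p'(1) by (meson continuous_on_polymonial_function real_polynomial_function_eq)
    then show ?thesis using p'(2) by (intro C1_differentiable_on_UNIV_I)
  qed
  show thesis
  proof
    show "(\<lambda>x. p k x * cutoff k x) \<in> C1c" for k by (rule cutoff_mult_C1c[OF c1])
    show "\<bar>p k x * cutoff k x\<bar> \<le> M + 1" if x: "x \<in> {0..1}" for k x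
    proof -
      have "\<bar>H k x\<bar> \<le> M" using M0 by (auto simp: H_def)
      moreover have "inverse (real (Suc k)) \<le> 1" by (simp add: divide_simps)
      ultimately have "\<bar>p k x\<bar> \<le> M + 1" using pH[OF x, of k] by linarith
      then show ?thesis
        using mult_mono[of "\<bar>p k x\<bar>" "M + 1" "cutoff k x" 1] cutoff_bounds[of k x] M0
        by (simp add: abs_mult)
    qed
    have "(\<lambda>k. p k x * cutoff k x) \<longlonglongrightarrow> g x" if x: "x \<in> {0..1}" "x \<notin> insert 0 (insert 1 N)" for x
    proof -
      have "(\<lambda>k. H k x) \<longlonglongrightarrow> max (-M) (min M (g x))"
        unfolding H_def using lim[of x] x by (intro tendsto_intros) auto
      also have "max (-M) (min M (g x)) = g x" using M[OF x(1)] by auto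
      finally have "(\<lambda>k. H k x) \<longlonglongrightarrow> g x" .
      moreover have "(\<lambda>k. p k x - H k x) \<longlonglongrightarrow> 0"
        by (rule Lim_null_comparison[OF _ LIMSEQ_inverse_real_of_nat])
           (use pH[OF x(1)] in \<open>auto intro!: always_eventually simp: abs_minus_commute less_imp_le\<close>)
      ultimately have "(\<lambda>k. p k x) \<longlonglongrightarrow> g x" using tendsto_add by fastforce
      moreover have "(\<lambda>k. cutoff k x) \<longlonglongrightarrow> 1" using x by (intro cutoff_tendsto_1) auto
      ultimately show ?thesis using tendsto_mult by fastforce
    qed
    then have pt: "x \<notin> insert 0 (insert 1 N) \<Longrightarrow> (\<lambda>k. p k x * cutoff k x) \<longlonglongrightarrow> g x" if "x \<in> {0..1}" for x
      using that by blast
    have "AE x in unit_leb. x \<notin> insert 0 (insert 1 N)"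
      using N by (intro AE_unit_leb_not_in) simp
    then show "AE x in unit_leb. (\<lambda>k. p k x * cutoff k x) \<longlonglongrightarrow> g x"
      by (rule lebesgue_on_mono) (rule pt)
  qed
qed

section \<open>Weak derivatives\<close>

lemma C1c_derivative:
  assumes "\<phi> \<in> C1c"
  shows "(\<phi> has_real_derivative deriv \<phi> x) (at x)" "continuous_on A (deriv \<phi>)" "continuous_on A \<phi>"
proof -
  obtain D where D: "\<And>x. (\<phi> has_real_derivative D x) (at x)" "continuous_on UNIV D"
    using assms unfolding C1c_def C1_differentiable_on_def
    by (auto simp: has_real_derivative_iff_has_vector_derivative)
  have "deriv \<phi> = D" using D(1) by (auto intro: DERIV_imp_deriv)
  then show "(\<phi> has_real_derivative deriv \<phi> x) (at x)" "continuous_on A (deriv \<phi>)" "continuous_on A \<phi>"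
    using D by (auto intro: continuous_on_subset DERIV_continuous_on DERIV_subset)
qed

lemma C1c_outside: "\<phi> \<in> C1c \<Longrightarrow> x \<notin> {0<..<1} \<Longrightarrow> \<phi> x = 0"
  using closure_subset[of "{x. \<phi> x \<noteq> 0}"] by (auto simp: C1c_def)

lemma C1c_in_L2: "\<phi> \<in> C1c \<Longrightarrow> \<phi> \<in> L2" "\<phi> \<in> C1c \<Longrightarrow> deriv \<phi> \<in> L2"
  by (auto intro: L2_continuous C1c_derivative)

lemma C1c_lincomb:
  assumes "\<phi> \<in> C1c" "\<psi> \<in> C1c"
  shows "(\<lambda>x. \<phi> x + c * \<psi> x) \<in> C1c" "deriv (\<lambda>x. \<phi> x + c * \<psi> x) = (\<lambda>x. deriv \<phi> x + c * deriv \<psi> x)"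
proof -
  have "{x. \<phi> x + c * \<psi> x \<noteq> 0} \<subseteq> {x. \<phi> x \<noteq> 0} \<union> {x. \<psi> x \<noteq> 0}" by auto
  from closure_mono[OF this] have sub: "closure {x. \<phi> x + c * \<psi> x \<noteq> 0}
      \<subseteq> closure {x. \<phi> x \<noteq> 0} \<union> closure {x. \<psi> x \<noteq> 0}" by (simp add: closure_Un)
  moreover have "compact (closure {x. \<phi> x \<noteq> 0} \<union> closure {x. \<psi> x \<noteq> 0})"
    using assms by (auto simp: C1c_def)
  ultimately have "compact (closure {x. \<phi> x + c * \<psi> x \<noteq> 0})"
    by (meson closed_closure bounded_subset compact_eq_bounded_closed)
  moreover have "(\<lambda>x. \<phi> x + c * \<psi> x) C1_differentiable_on UNIV"
    using assms by (auto simp: C1c_def intro!: C1_differentiable_on_add C1_differentiable_on_mult)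
  ultimately show "(\<lambda>x. \<phi> x + c * \<psi> x) \<in> C1c" using sub assms by (auto simp: C1c_def)
  show "deriv (\<lambda>x. \<phi> x + c * \<psi> x) = (\<lambda>x. deriv \<phi> x + c * deriv \<psi> x)"
    by (intro ext DERIV_imp_deriv) (auto intro!: derivative_eq_intros C1c_derivative assms)
qed

lemma leb_int_FTC:
  assumes "a \<le> b" "finite S" "continuous_on {a..b} f"
    "\<And>x. x \<in> {a<..<b} - S \<Longrightarrow> (f has_real_derivative f' x) (at x)"
    "integrable (lebesgue_on {a..b}) f'"
  shows "leb_int a b f' = f b - f a"
proof -
  have "(f' has_integral (f b - f a)) {a..b}"
    using assms by (intro fundamental_theorem_of_calculus_interior_strong[of S])
      (auto simp: has_real_derivative_iff_has_vector_derivative)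
  then show ?thesis
    using lebesgue_integral_eq_integral[OF assms(5)] by (simp add: leb_int_def integral_unique)
qed

lemma C1c_integration_by_parts:
  assumes "\<phi> \<in> C1c" "\<psi> \<in> C1c"
  shows "leb_int 0 1 (\<lambda>x. \<phi> x * deriv \<psi> x) = - leb_int 0 1 (\<lambda>x. deriv \<phi> x * \<psi> x)"
proof -
  have i: "integrable unit_leb (\<lambda>x. \<phi> x * deriv \<psi> x)" "integrable unit_leb (\<lambda>x. deriv \<phi> x * \<psi> x)"
    using assms by (auto intro: integrable_mult_L2 C1c_in_L2)
  have "leb_int 0 1 (\<lambda>x. \<phi> x * deriv \<psi> x + deriv \<phi> x * \<psi> x) = \<phi> 1 * \<psi> 1 - \<phi> 0 * \<psi> 0"
    by (rule leb_int_FTC[where S = "{}"])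
      (use i C1c_derivative[OF assms(1)] C1c_derivative[OF assms(2)]
        in \<open>auto intro!: continuous_intros derivative_eq_intros\<close>)
  then show ?thesis using i assms by (simp add: leb_int_def C1c_outside)
qed

text \<open>Testing against smooth approximations of \<open>sgn d\<close> bounds the \<open>L\<^sup>1\<close> norm of \<open>d\<close>.\<close>

lemma L2_orthogonal_C1c_imp_AE_zero:
  assumes d: "d \<in> L2" and orth: "\<And>\<phi>. \<phi> \<in> C1c \<Longrightarrow> leb_int 0 1 (\<lambda>x. d x * \<phi> x) = 0"
  shows "AE x in unit_leb. d x = 0"
proof -
  have m: "d \<in> borel_measurable unit_leb" using d by (rule L2D)
  have "(\<lambda>x. sgn (d x)) \<in> borel_measurable unit_leb"
    using m by measurable
  then obtain \<phi> where \<phi>: "\<And>k. \<phi> k \<in> C1c" "\<And>k x. x \<in> {0..1} \<Longrightarrow> \<bar>\<phi> k x\<bar> \<le> 1 + 1"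
    and lim: "AE x in unit_leb. (\<lambda>k. \<phi> k x) \<longlonglongrightarrow> sgn (d x)"
    by (rule C1c_approximation[where M = 1]) (auto simp: sgn_if)
  have "(\<lambda>k. LINT x|unit_leb. d x * \<phi> k x) \<longlonglongrightarrow> (LINT x|unit_leb. \<bar>d x\<bar>)"
  proof (rule integral_dominated_convergence[where w = "\<lambda>x. 2 * \<bar>d x\<bar>"])
    show "integrable unit_leb (\<lambda>x. 2 * \<bar>d x\<bar>)" using L2_integrable[OF d] by auto
    show "(\<lambda>x. d x * \<phi> k x) \<in> borel_measurable unit_leb" for k
      using m L2D(1)[OF C1c_in_L2(1)[OF \<phi>(1)]] by auto
    show "AE x in unit_leb. (\<lambda>k. d x * \<phi> k x) \<longlonglongrightarrow> \<bar>d x\<bar>"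
      using lim
    proof eventually_elim
      case (elim x)
      have "(\<lambda>k. d x * \<phi> k x) \<longlonglongrightarrow> d x * sgn (d x)" using elim by (intro tendsto_intros)
      then show ?case by (simp add: abs_sgn)
    qed
    show "AE x in unit_leb. norm (d x * \<phi> k x) \<le> 2 * \<bar>d x\<bar>" for k
    proof (rule AE_I2)
      fix x assume "x \<in> space unit_leb"
      then have "\<bar>\<phi> k x\<bar> \<le> 2" using \<phi>(2)[of x k] by simp
      then show "norm (d x * \<phi> k x) \<le> 2 * \<bar>d x\<bar>"
        using mult_left_mono[of "\<bar>\<phi> k x\<bar>" 2 "\<bar>d x\<bar>"] by (simp add: abs_mult mult.commute[of _ 2])
    qed
  qed (use m in auto)
  moreover have "(LINT x|unit_leb. d x * \<phi> k x) = 0" for k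
    using orth[OF \<phi>(1)] by (simp add: leb_int_def)
  ultimately have "(LINT x|unit_leb. \<bar>d x\<bar>) = 0" by (simp add: LIMSEQ_const_iff)
  then have "AE x in unit_leb. \<bar>d x\<bar> = 0"
    using L2_integrable[OF d] by (subst (asm) integral_nonneg_eq_0_iff_AE) auto
  then show ?thesis by simp
qed

lemma weak_deriv_unique:
  assumes "is_weak_deriv u g" "is_weak_deriv u g'"
  shows "AE x in unit_leb. g x = g' x"
proof -
  have L: "g \<in> L2" "g' \<in> L2" using assms by (auto simp: is_weak_deriv_def)
  have "leb_int 0 1 (\<lambda>x. (g x - g' x) * \<phi> x) = 0" if "\<phi> \<in> C1c" for \<phi>
  proof -
    have "leb_int 0 1 (\<lambda>x. g x * \<phi> x) = leb_int 0 1 (\<lambda>x. g' x * \<phi> x)"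
      using assms that by (auto simp: is_weak_deriv_def)
    then show ?thesis
      using L that by (simp add: leb_int_def left_diff_distrib integrable_mult_L2 C1c_in_L2)
  qed
  then have "AE x in unit_leb. g x - g' x = 0"
    using L by (intro L2_orthogonal_C1c_imp_AE_zero L2_diff)
  then show ?thesis by simp
qed

lemma is_weak_deriv_wderiv: "is_weak_deriv u g \<Longrightarrow> is_weak_deriv u (wderiv u)"
  unfolding wderiv_def by (rule someI[where P = "is_weak_deriv u"])

lemma wderiv_AE_eq: "is_weak_deriv u g \<Longrightarrow> AE x in unit_leb. wderiv u x = g x"
  by (rule weak_deriv_unique[OF is_weak_deriv_wderiv])

lemma leb_int_cong_AE:
  assumes "AE x in unit_leb. f x = g x" "f \<in> borel_measurable unit_leb" "g \<in> borel_measurable unit_leb"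
  shows "leb_int 0 1 f = leb_int 0 1 g"
  unfolding leb_int_def using assms by (intro integral_cong_AE) auto

section \<open>The closure of the test functions\<close>

text \<open>
  The closure of the graph of the derivative on test functions. It is easier to handle than
  \<^const>\<open>H10\<close> itself because the derivative is an explicit second component.
\<close>

definition H10_graph :: "(real \<Rightarrow> real) \<Rightarrow> (real \<Rightarrow> real) \<Rightarrow> bool" where
  "H10_graph u g \<longleftrightarrow> u \<in> L2 \<and> g \<in> L2 \<and> (\<forall>e>0. \<exists>\<phi>\<in>C1c.
     leb_int 0 1 (\<lambda>x. (u x - \<phi> x)\<^sup>2) + leb_int 0 1 (\<lambda>x. (g x - deriv \<phi> x)\<^sup>2) < e)"

lemma leb_int_square_nonneg: "0 \<le> leb_int a b (\<lambda>x. (f x :: real)\<^sup>2)"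
  by (simp add: leb_int_def)

lemma leb_int_diff_L2:
  assumes "a \<in> L2" "f \<in> L2" "g \<in> L2"
  shows "leb_int 0 1 (\<lambda>x. a x * (f x - g x)) = leb_int 0 1 (\<lambda>x. a x * f x) - leb_int 0 1 (\<lambda>x. a x * g x)"
  using assms by (simp add: leb_int_def right_diff_distrib integrable_mult_L2)

text \<open>
  Both sides are continuous in \<open>(u, g)\<close> with respect to the \<open>L\<^sup>2\<close> norms by Cauchy--Schwarz, so the
  identity passes from the graph of the derivative on test functions to its closure.
\<close>

lemma H10_graph_extend:
  assumes "H10_graph u g" and L: "\<alpha> \<in> L2" "\<kappa> \<in> L2"
    and id: "\<And>\<phi>. \<phi> \<in> C1c \<Longrightarrow> leb_int 0 1 (\<lambda>x. \<alpha> x * \<phi> x) = leb_int 0 1 (\<lambda>x. \<kappa> x * deriv \<phi> x)"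
  shows "leb_int 0 1 (\<lambda>x. \<alpha> x * u x) = leb_int 0 1 (\<lambda>x. \<kappa> x * g x)"
proof -
  have ug: "u \<in> L2" "g \<in> L2" using assms by (auto simp: H10_graph_def)
  define c where "c = sqrt (leb_int 0 1 (\<lambda>x. (\<alpha> x)\<^sup>2)) + sqrt (leb_int 0 1 (\<lambda>x. (\<kappa> x)\<^sup>2))"
  define D where "D = \<bar>leb_int 0 1 (\<lambda>x. \<alpha> x * u x) - leb_int 0 1 (\<lambda>x. \<kappa> x * g x)\<bar>"
  have c0: "0 \<le> c" by (simp add: c_def leb_int_square_nonneg)
  have "D \<le> 0 + e" if e: "e > 0" for e
  proof -
    define r where "r = e / (c + 1)"
    have r: "r > 0" using e c0 by (simp add: r_def)
    have "r\<^sup>2 > 0" using r by simp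
    then obtain \<phi> where \<phi>: "\<phi> \<in> C1c" and lt: "leb_int 0 1 (\<lambda>x. (u x - \<phi> x)\<^sup>2)
         + leb_int 0 1 (\<lambda>x. (g x - deriv \<phi> x)\<^sup>2) < r\<^sup>2"
      using assms(1) unfolding H10_graph_def by blast
    have "sqrt (leb_int 0 1 (\<lambda>x. (u x - \<phi> x)\<^sup>2)) \<le> r" "sqrt (leb_int 0 1 (\<lambda>x. (g x - deriv \<phi> x)\<^sup>2)) \<le> r"
      using lt r leb_int_square_nonneg[of 0 1 "\<lambda>x. u x - \<phi> x"]
        leb_int_square_nonneg[of 0 1 "\<lambda>x. g x - deriv \<phi> x"]
      by (auto intro!: real_le_lsqrt)
    note small = this
    have "D = \<bar>leb_int 0 1 (\<lambda>x. \<alpha> x * (u x - \<phi> x)) - leb_int 0 1 (\<lambda>x. \<kappa> x * (g x - deriv \<phi> x))\<bar>"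
      using id[OF \<phi>] by (simp add: D_def leb_int_diff_L2 L ug C1c_in_L2 \<phi>)
    also have "\<dots> \<le> \<bar>leb_int 0 1 (\<lambda>x. \<alpha> x * (u x - \<phi> x))\<bar> + \<bar>leb_int 0 1 (\<lambda>x. \<kappa> x * (g x - deriv \<phi> x))\<bar>"
      by (rule abs_triangle_ineq4)
    also have "\<dots> \<le> sqrt (leb_int 0 1 (\<lambda>x. (\<alpha> x)\<^sup>2)) * sqrt (leb_int 0 1 (\<lambda>x. (u x - \<phi> x)\<^sup>2))
        + sqrt (leb_int 0 1 (\<lambda>x. (\<kappa> x)\<^sup>2)) * sqrt (leb_int 0 1 (\<lambda>x. (g x - deriv \<phi> x)\<^sup>2))"
      by (intro add_mono L2_Cauchy_Schwarz L L2_diff ug C1c_in_L2 \<phi>)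
    also have "\<dots> \<le> sqrt (leb_int 0 1 (\<lambda>x. (\<alpha> x)\<^sup>2)) * r + sqrt (leb_int 0 1 (\<lambda>x. (\<kappa> x)\<^sup>2)) * r"
      using small by (intro add_mono mult_left_mono) (auto simp: leb_int_square_nonneg)
    also have "\<dots> = c * r" by (simp add: c_def algebra_simps)
    also have "\<dots> \<le> (c + 1) * r" using r by (simp add: mult_right_mono)
    also have "\<dots> = e" using c0 by (simp add: r_def)
    finally show ?thesis by simp
  qed
  then have "D \<le> 0" by (rule field_le_epsilon)
  then show ?thesis by (simp add: D_def)
qed

text \<open>Integration by parts against a fixed \<open>\<psi>\<close> is an identity of the kind that extends.\<close>

lemma H10_graph_weak_deriv:
  assumes "H10_graph u g" shows "is_weak_deriv u g"
proof -
  have "leb_int 0 1 (\<lambda>x. u x * deriv \<psi> x) = - leb_int 0 1 (\<lambda>x. g x * \<psi> x)" if \<psi>: "\<psi> \<in> C1c" for \<psi>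
  proof -
    have "leb_int 0 1 (\<lambda>x. deriv \<psi> x * u x) = leb_int 0 1 (\<lambda>x. - 1 * \<psi> x * g x)"
    proof (rule H10_graph_extend[OF assms])
      show "deriv \<psi> \<in> L2" "(\<lambda>x. - 1 * \<psi> x) \<in> L2" using \<psi> by (intro C1c_in_L2 L2_scale; simp)+
      show "leb_int 0 1 (\<lambda>x. deriv \<psi> x * \<phi> x) = leb_int 0 1 (\<lambda>x. - 1 * \<psi> x * deriv \<phi> x)"
        if "\<phi> \<in> C1c" for \<phi>
        using C1c_integration_by_parts[OF \<psi> that] by (simp add: leb_int_def)
    qed
    then show ?thesis by (simp add: leb_int_def mult.commute)
  qed
  then show ?thesis using assms by (auto simp: is_weak_deriv_def H10_graph_def)
qed

lemma is_weak_deriv_C1c: "\<phi> \<in> C1c \<Longrightarrow> is_weak_deriv \<phi> (deriv \<phi>)"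
  by (auto simp: is_weak_deriv_def C1c_in_L2 C1c_integration_by_parts)

lemma is_weak_deriv_diff:
  assumes "is_weak_deriv u g" "is_weak_deriv v h" "u \<in> L2" "v \<in> L2"
  shows "is_weak_deriv (\<lambda>x. u x - v x) (\<lambda>x. g x - h x)"
  using assms by (auto simp: is_weak_deriv_def L2_diff left_diff_distrib leb_int_def integrable_mult_L2 C1c_in_L2)

lemma H1_norm_diff_C1c:
  assumes "is_weak_deriv u g" "u \<in> L2" "\<phi> \<in> C1c"
  shows "(H1_norm (\<lambda>x. u x - \<phi> x))\<^sup>2
    = leb_int 0 1 (\<lambda>x. (u x - \<phi> x)\<^sup>2) + leb_int 0 1 (\<lambda>x. (g x - deriv \<phi> x)\<^sup>2)"
proof -
  have w: "is_weak_deriv (\<lambda>x. u x - \<phi> x) (\<lambda>x. g x - deriv \<phi> x)"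
    using assms(1) is_weak_deriv_C1c[OF assms(3)] assms(2) C1c_in_L2(1)[OF assms(3)]
    by (rule is_weak_deriv_diff)
  have "leb_int 0 1 (\<lambda>x. (wderiv (\<lambda>x. u x - \<phi> x) x)\<^sup>2) = leb_int 0 1 (\<lambda>x. (g x - deriv \<phi> x)\<^sup>2)"
  proof (rule leb_int_cong_AE)
    show "AE x in unit_leb. (wderiv (\<lambda>x. u x - \<phi> x) x)\<^sup>2 = (g x - deriv \<phi> x)\<^sup>2"
      using wderiv_AE_eq[OF w] by eventually_elim simp
  qed (use w is_weak_deriv_wderiv[OF w] in \<open>auto simp: is_weak_deriv_def L2_def\<close>)
  then show ?thesis by (simp add: H1_norm_def leb_int_square_nonneg)
qed

lemma H10_iff_graph: "u \<in> H10 \<longleftrightarrow> (\<exists>g. H10_graph u g)"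
proof
  assume u: "u \<in> H10"
  then obtain g where g: "is_weak_deriv u g" "u \<in> L2" by (auto simp: H10_def H1_def)
  have "\<exists>\<phi>\<in>C1c. leb_int 0 1 (\<lambda>x. (u x - \<phi> x)\<^sup>2) + leb_int 0 1 (\<lambda>x. (g x - deriv \<phi> x)\<^sup>2) < e"
    if e: "e > 0" for e
  proof -
    have "sqrt e > 0" using e by simp
    then obtain \<phi> where \<phi>: "\<phi> \<in> C1c" "H1_norm (\<lambda>x. u x - \<phi> x) < sqrt e"
      using u unfolding H10_def by blast
    have "0 \<le> H1_norm (\<lambda>x. u x - \<phi> x)" by (simp add: H1_norm_def leb_int_square_nonneg)
    then have "(H1_norm (\<lambda>x. u x - \<phi> x))\<^sup>2 < (sqrt e)\<^sup>2" using \<phi>(2) by (intro power_strict_mono) auto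
    then show ?thesis using H1_norm_diff_C1c[OF g \<phi>(1)] e \<phi>(1) by auto
  qed
  then show "\<exists>g. H10_graph u g" using g by (auto simp: H10_graph_def is_weak_deriv_def)
next
  assume "\<exists>g. H10_graph u g"
  then obtain g where g: "H10_graph u g" by blast
  have w: "is_weak_deriv u g" by (rule H10_graph_weak_deriv[OF g])
  have L: "u \<in> L2" using g by (simp add: H10_graph_def)
  have "\<exists>\<phi>\<in>C1c. H1_norm (\<lambda>x. u x - \<phi> x) < e" if e: "e > 0" for e
  proof -
    have "e\<^sup>2 > 0" using e by simp
    then obtain \<phi> where \<phi>: "\<phi> \<in> C1c"
      and lt: "leb_int 0 1 (\<lambda>x. (u x - \<phi> x)\<^sup>2) + leb_int 0 1 (\<lambda>x. (g x - deriv \<phi> x)\<^sup>2) < e\<^sup>2"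
      using g unfolding H10_graph_def by blast
    have "(H1_norm (\<lambda>x. u x - \<phi> x))\<^sup>2 < e\<^sup>2" using lt H1_norm_diff_C1c[OF w L \<phi>] by simp
    then have "H1_norm (\<lambda>x. u x - \<phi> x) < e" by (rule power2_less_imp_less) (use e in auto)
    then show ?thesis using \<phi> by blast
  qed
  moreover have "u \<in> H1" using w L unfolding H1_def by blast
  ultimately show "u \<in> H10" unfolding H10_def by simp
qed

lemma H10_graph_cong_AE:
  assumes "H10_graph u g" "g' \<in> L2" "AE x in unit_leb. g x = g' x"
  shows "H10_graph u g'"
proof -
  have "leb_int 0 1 (\<lambda>x. (g x - deriv \<phi> x)\<^sup>2) = leb_int 0 1 (\<lambda>x. (g' x - deriv \<phi> x)\<^sup>2)" if "\<phi> \<in> C1c" for \<phi>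
  proof (rule leb_int_cong_AE)
    show "AE x in unit_leb. (g x - deriv \<phi> x)\<^sup>2 = (g' x - deriv \<phi> x)\<^sup>2"
      using assms(3) by eventually_elim simp
  qed (use assms L2D(1)[OF C1c_in_L2(2)[OF that]] in \<open>auto simp: H10_graph_def L2_def\<close>)
  then show ?thesis using assms by (simp add: H10_graph_def)
qed

lemma H10_graph_wderiv: "u \<in> H10 \<Longrightarrow> H10_graph u (wderiv u)"
proof -
  assume "u \<in> H10"
  then obtain g where g: "H10_graph u g" by (auto simp: H10_iff_graph)
  have w: "is_weak_deriv u g" by (rule H10_graph_weak_deriv[OF g])
  show ?thesis
    using is_weak_deriv_wderiv[OF w] weak_deriv_unique[OF w is_weak_deriv_wderiv[OF w]]
    by (intro H10_graph_cong_AE[OF g]) (auto simp: is_weak_deriv_def)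
qed

lemma H10_graph_lincomb:
  assumes "H10_graph u g" "H10_graph v h"
  shows "H10_graph (\<lambda>x. u x + c * v x) (\<lambda>x. g x + c * h x)"
proof -
  have L: "u \<in> L2" "g \<in> L2" "v \<in> L2" "h \<in> L2" using assms by (auto simp: H10_graph_def)
  have sq: "leb_int 0 1 (\<lambda>x. (a x + c * b x - (a' x + c * b' x))\<^sup>2)
      \<le> 2 * leb_int 0 1 (\<lambda>x. (a x - a' x)\<^sup>2) + 2 * c\<^sup>2 * leb_int 0 1 (\<lambda>x. (b x - b' x)\<^sup>2)"
    if ab: "a \<in> L2" "b \<in> L2" "a' \<in> L2" "b' \<in> L2" for a b a' b'
  proof -
    have d: "(\<lambda>x. a x - a' x) \<in> L2" "(\<lambda>x. b x - b' x) \<in> L2" using ab by (auto intro: L2_diff)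
    have "(\<lambda>x. a x + c * b x - (a' x + c * b' x)) \<in> L2" using ab by (intro L2_diff L2_add L2_scale)
    then have "leb_int 0 1 (\<lambda>x. (a x + c * b x - (a' x + c * b' x))\<^sup>2)
        \<le> leb_int 0 1 (\<lambda>x. 2 * (a x - a' x)\<^sup>2 + 2 * c\<^sup>2 * (b x - b' x)\<^sup>2)"
      unfolding leb_int_def
    proof (intro integral_mono)
      fix x
      have "(s + c * t)\<^sup>2 \<le> 2 * s\<^sup>2 + 2 * c\<^sup>2 * t\<^sup>2" for s t
        using sum_squares_bound[of s "c * t"] by (simp add: power2_sum power_mult_distrib)
      from this[of "a x - a' x" "b x - b' x"]
      show "(a x + c * b x - (a' x + c * b' x))\<^sup>2 \<le> 2 * (a x - a' x)\<^sup>2 + 2 * c\<^sup>2 * (b x - b' x)\<^sup>2"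
        by (simp add: algebra_simps)
    qed (use d in \<open>auto simp: L2_def\<close>)
    then show ?thesis using d by (simp add: leb_int_def L2_def)
  qed
  have "\<exists>\<phi>\<in>C1c. leb_int 0 1 (\<lambda>x. (u x + c * v x - \<phi> x)\<^sup>2)
      + leb_int 0 1 (\<lambda>x. (g x + c * h x - deriv \<phi> x)\<^sup>2) < e" if e: "e > 0" for e
  proof -
    \<comment> \<open>The tolerance for \<open>v\<close> is divided by \<open>c\<^sup>2 + 1\<close>, which is nonzero also for \<open>c = 0\<close>.\<close>
    have c1: "c\<^sup>2 + 1 > 0" by (simp add: add_nonneg_pos)
    have "e / 4 > 0" "e / (4 * (c\<^sup>2 + 1)) > 0" using e c1 by auto
    then obtain \<phi> \<psi> where \<phi>: "\<phi> \<in> C1c" and \<psi>: "\<psi> \<in> C1c" and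
      b1: "leb_int 0 1 (\<lambda>x. (u x - \<phi> x)\<^sup>2) + leb_int 0 1 (\<lambda>x. (g x - deriv \<phi> x)\<^sup>2) < e / 4" and
      b2: "leb_int 0 1 (\<lambda>x. (v x - \<psi> x)\<^sup>2) + leb_int 0 1 (\<lambda>x. (h x - deriv \<psi> x)\<^sup>2) < e / (4 * (c\<^sup>2 + 1))"
      using assms unfolding H10_graph_def by meson
    let ?b2 = "leb_int 0 1 (\<lambda>x. (v x - \<psi> x)\<^sup>2) + leb_int 0 1 (\<lambda>x. (h x - deriv \<psi> x)\<^sup>2)"
    have "2 * c\<^sup>2 * ?b2 \<le> 2 * (c\<^sup>2 + 1) * ?b2"
      by (intro mult_right_mono add_nonneg_nonneg leb_int_square_nonneg) simp
    also have "\<dots> < e / 2" using b2 c1 by (simp add: field_simps)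
    finally have b2': "2 * c\<^sup>2 * ?b2 < e / 2" .
    have "leb_int 0 1 (\<lambda>x. (u x + c * v x - (\<phi> x + c * \<psi> x))\<^sup>2)
      + leb_int 0 1 (\<lambda>x. (g x + c * h x - (deriv \<phi> x + c * deriv \<psi> x))\<^sup>2)
      \<le> 2 * (leb_int 0 1 (\<lambda>x. (u x - \<phi> x)\<^sup>2) + leb_int 0 1 (\<lambda>x. (g x - deriv \<phi> x)\<^sup>2)) + 2 * c\<^sup>2 * ?b2"
      using sq[of u v \<phi> \<psi>] sq[of g h "deriv \<phi>" "deriv \<psi>"] L C1c_in_L2 \<phi> \<psi>
      by (simp add: distrib_left)
    also have "\<dots> < 2 * (e / 4) + e / 2"
      using b1 b2' by (intro add_strict_mono mult_strict_left_mono) auto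
    also have "\<dots> = e" by simp
    finally show ?thesis
      using C1c_lincomb[OF \<phi> \<psi>, of c] by (intro bexI[of _ "\<lambda>x. \<phi> x + c * \<psi> x"]) simp_all
  qed
  then show ?thesis using L by (auto simp: H10_graph_def intro: L2_add L2_scale)
qed

section \<open>Piecewise smooth functions and integrals of Sobolev functions\<close>

text \<open>The vanishing mean makes the primitive from the left vanish again near the right end point.\<close>

lemma C1c_primitive:
  assumes \<theta>: "\<theta> \<in> C1c" and zero: "leb_int 0 1 \<theta> = 0"
  obtains F where "F \<in> C1c" "\<And>x. (F has_real_derivative \<theta> x) (at x)"
proof -
  have cont: "continuous_on A \<theta>" for A by (rule C1c_derivative[OF \<theta>])
  define K where "K = insert (1/2) (closure {x. \<theta> x \<noteq> 0})"
  have K: "compact K" "K \<noteq> {}" "K \<subseteq> {0<..<1}" using \<theta> by (auto simp: K_def C1c_def)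
  obtain a where a: "a \<in> K" "\<And>x. x \<in> K \<Longrightarrow> a \<le> x" using compact_attains_inf[OF K(1,2)] by blast
  obtain b where b: "b \<in> K" "\<And>x. x \<in> K \<Longrightarrow> x \<le> b" using compact_attains_sup[OF K(1,2)] by blast
  have ab: "0 < a" "a \<le> b" "b < 1" using a b K by auto
  have out: "\<theta> x = 0" if "x < a \<or> b < x" for x
  proof (rule ccontr)
    assume "\<theta> x \<noteq> 0"
    then have "x \<in> K" using closure_subset[of "{x. \<theta> x \<noteq> 0}"] by (auto simp: K_def)
    then show False using a(2)[of x] b(2)[of x] that by auto
  qed
  define F where "F x = (if x \<in> {0..1} then integral {0..x} \<theta> else 0)" for x
  have tot: "integral {0..1} \<theta> = 0"
    using zero lebesgue_integral_eq_integral[OF L2_integrable[OF C1c_in_L2(1)[OF \<theta>]]]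
    by (simp add: leb_int_def)
  have F0: "F x = 0" if "x < a" for x
  proof (cases "x \<in> {0..1}")
    case True
    have "integral {0..x} \<theta> = integral {0..x} (\<lambda>x. 0)"
      using that by (intro Henstock_Kurzweil_Integration.integral_cong out) auto
    then show ?thesis using True by (simp add: F_def)
  qed (auto simp: F_def)
  have F1: "F x = 0" if "b < x" for x
  proof (cases "x \<in> {0..1}")
    case True
    have "integral {x..1} \<theta> = integral {x..1} (\<lambda>x. 0)"
      using that by (intro Henstock_Kurzweil_Integration.integral_cong out) auto
    moreover have "integral {0..x} \<theta> + integral {x..1} \<theta> = integral {0..1} \<theta>"
      using True cont by (intro Henstock_Kurzweil_Integration.integral_combine integrable_continuous_real) auto
    ultimately show ?thesis using True tot by (simp add: F_def)
  qed (auto simp: F_def)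
  have D: "(F has_real_derivative \<theta> x) (at x)" for x
  proof -
    consider "x < a" | "b < x" | "0 < x" "x < 1" using ab by linarith
    then show ?thesis
    proof cases
      case 1
      have "((\<lambda>x. 0) has_real_derivative \<theta> x) (at x)" using out[of x] 1 by simp
      then show ?thesis
        by (rule has_field_derivative_transform_within_open[where S = "{..<a}"]) (use 1 F0 in auto)
    next
      case 2
      have "((\<lambda>x. 0) has_real_derivative \<theta> x) (at x)" using out[of x] 2 by simp
      then show ?thesis
        by (rule has_field_derivative_transform_within_open[where S = "{b<..}"]) (use 2 F1 in auto)
    next
      case 3
      have "((\<lambda>x. integral {0..x} \<theta>) has_real_derivative \<theta> x) (at x within {0..1})"
        using 3 by (intro integral_has_real_derivative cont) auto
      then have "((\<lambda>x. integral {0..x} \<theta>) has_real_derivative \<theta> x) (at x)"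
        using 3 at_within_interior[of x "{0..1}"] by simp
      then show ?thesis
        by (rule has_field_derivative_transform_within_open[where S = "{0<..<1}"])
          (use 3 in \<open>auto simp: F_def\<close>)
    qed
  qed
  have "{x. F x \<noteq> 0} \<subseteq> {a..b}" using F0 F1 by (auto simp: not_less[symmetric])
  then have sub: "closure {x. F x \<noteq> 0} \<subseteq> {a..b}" by (rule closure_minimal) auto
  then have "compact (closure {x. F x \<noteq> 0})"
    by (meson bounded_closed_interval bounded_subset closed_closure compact_eq_bounded_closed)
  moreover have "closure {x. F x \<noteq> 0} \<subseteq> {0<..<1}" using sub ab by auto
  ultimately have "F \<in> C1c"
    using C1_differentiable_on_UNIV_I[OF D cont] by (simp add: C1c_def)
  with D that show thesis by blast
qed

lemma C1c_bump:
  obtains \<psi> B where "\<psi> \<in> C1c" "leb_int 0 1 \<psi> = 1" "\<And>x. \<bar>\<psi> x\<bar> \<le> B"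
proof -
  have c: "cutoff k \<in> C1c" for k using cutoff_mult_C1c[of "\<lambda>_. 1" k] by simp
  have "(\<lambda>k. LINT x|unit_leb. cutoff k x) \<longlonglongrightarrow> (LINT x|unit_leb. 1)"
  proof (rule integral_dominated_convergence[where w = "\<lambda>x. 1"])
    show "cutoff k \<in> borel_measurable unit_leb" for k by (intro L2D C1c_in_L2 c)
    have "AE x in unit_leb. x \<notin> {0, 1}" by (intro AE_unit_leb_not_in) simp
    then show "AE x in unit_leb. (\<lambda>k. cutoff k x) \<longlonglongrightarrow> 1"
      by (rule lebesgue_on_mono) (auto intro!: cutoff_tendsto_1)
    show "AE x in unit_leb. norm (cutoff k x) \<le> 1" for k using cutoff_bounds[of k] by auto
  qed auto
  then have "(\<lambda>k. leb_int 0 1 (cutoff k)) \<longlonglongrightarrow> 1"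
    by (simp add: leb_int_def measure_restrict_space)
  then have "\<forall>\<^sub>F k in sequentially. leb_int 0 1 (cutoff k) > 0"
    by (rule order_tendstoD) simp
  then obtain k where k: "leb_int 0 1 (cutoff k) > 0"
    by (meson eventually_happens sequentially_bot)
  define I where "I = leb_int 0 1 (cutoff k)"
  show thesis
  proof
    show "(\<lambda>x. 1 / I * cutoff k x) \<in> C1c" by (rule cutoff_mult_C1c) simp
    show "leb_int 0 1 (\<lambda>x. 1 / I * cutoff k x) = 1" using k by (simp add: I_def leb_int_def)
    show "\<bar>1 / I * cutoff k x\<bar> \<le> 1 / I" for x
      using k cutoff_bounds[of k x] by (simp add: I_def[symmetric] divide_right_mono)
  qed
qed

lemma leb_int_subinterval_sq_bound:
  assumes d: "d \<in> L2" and x: "x \<in> {0..1}"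
  shows "(leb_int 0 x d)\<^sup>2 \<le> leb_int 0 1 (\<lambda>y. (d y)\<^sup>2)"
proof -
  have i2: "integrable (lebesgue_on {0..x}) (\<lambda>y. (d y)\<^sup>2)"
    using integrable_subinterval[of 0 1 "\<lambda>y. (d y)\<^sup>2" 0 x] d x by (auto simp: L2_def)
  have i1: "integrable (lebesgue_on {0..x}) d"
    using integrable_subinterval[of 0 1 d 0 x] L2_integrable[OF d] x by auto
  have "(leb_int 0 x d)\<^sup>2 \<le> leb_int 0 x (\<lambda>y. (d y)\<^sup>2) * x"
    using integral_Cauchy_Schwarz[of "lebesgue_on {0..x}" d "\<lambda>_. 1"] i1 i2 x
    by (simp add: leb_int_def measure_restrict_space)
  also have "\<dots> \<le> leb_int 0 x (\<lambda>y. (d y)\<^sup>2)"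
    using x leb_int_square_nonneg[of 0 x d] by (simp add: mult_left_le)
  also have "\<dots> \<le> leb_int 0 1 (\<lambda>y. (d y)\<^sup>2)"
    using Equivalence_Measurable_On_Borel.integral_combine[of 0 1 "\<lambda>y. (d y)\<^sup>2" x] x d
      leb_int_square_nonneg[of x 1 d] by (simp add: leb_int_def L2_def)
  finally show ?thesis .
qed

text \<open>
  The approximations \<open>\<phi> k\<close> of \<open>g\<close> have means tending to zero; subtracting these means times a fixed
  bump corrects them without affecting the limit.
\<close>

lemma C1c_mean_zero_approximation:
  assumes g: "g \<in> borel_measurable unit_leb" and M: "\<And>x. x \<in> {0..1} \<Longrightarrow> \<bar>g x\<bar> \<le> M"
    and mean: "leb_int 0 1 g = 0" and e: "e > 0"
  obtains \<theta> where "\<theta> \<in> C1c" "leb_int 0 1 \<theta> = 0" "leb_int 0 1 (\<lambda>x. (g x - \<theta> x)\<^sup>2) < e"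
proof -
  obtain \<phi> where \<phi>: "\<And>k. \<phi> k \<in> C1c" "\<And>k x. x \<in> {0..1} \<Longrightarrow> \<bar>\<phi> k x\<bar> \<le> M + 1"
    and lim: "AE x in unit_leb. (\<lambda>k. \<phi> k x) \<longlonglongrightarrow> g x"
    using C1c_approximation[OF g M] by blast
  obtain \<psi> B where \<psi>: "\<psi> \<in> C1c" "leb_int 0 1 \<psi> = 1" "\<And>x. \<bar>\<psi> x\<bar> \<le> B" by (rule C1c_bump) blast
  have M0: "0 \<le> M" using M[of 0] by simp
  have B0: "0 \<le> B" using \<psi>(3)[of 0] by simp
  have ms: "\<phi> k \<in> borel_measurable unit_leb" "\<psi> \<in> borel_measurable unit_leb" for k
    by (intro L2D C1c_in_L2 \<phi> \<psi>)+
  define m where "m k = leb_int 0 1 (\<phi> k)" for k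
  have m: "m \<longlonglongrightarrow> 0"
  proof -
    have "(\<lambda>k. LINT x|unit_leb. \<phi> k x) \<longlonglongrightarrow> (LINT x|unit_leb. g x)"
      by (rule integral_dominated_convergence[where w = "\<lambda>x. M + 1"])
        (use ms g lim \<phi> in auto)
    then show ?thesis using mean by (simp add: m_def[abs_def] leb_int_def)
  qed
  then obtain C where C: "\<And>k. \<bar>m k\<bar> \<le> C"
    using convergent_imp_Bseq[of m] by (auto simp: convergent_def Bseq_def)
  have C0: "0 \<le> C" using C[of 0] by simp
  have "(\<lambda>k. LINT x|unit_leb. (g x - (\<phi> k x + - m k * \<psi> x))\<^sup>2) \<longlonglongrightarrow> (LINT x|unit_leb. 0)"
  proof (rule integral_dominated_convergence[where w = "\<lambda>x. (M + ((M + 1) + C * B))\<^sup>2"])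
    show "(\<lambda>x. (g x - (\<phi> k x + - m k * \<psi> x))\<^sup>2) \<in> borel_measurable unit_leb" for k
      using ms g by measurable
    show "AE x in unit_leb. (\<lambda>k. (g x - (\<phi> k x + - m k * \<psi> x))\<^sup>2) \<longlonglongrightarrow> 0"
      using lim
    proof eventually_elim
      case (elim x)
      have "(\<lambda>k. (g x - (\<phi> k x + - m k * \<psi> x))\<^sup>2) \<longlonglongrightarrow> (g x - (g x + - 0 * \<psi> x))\<^sup>2"
        using elim m by (intro tendsto_intros)
      then show ?case by simp
    qed
    show "AE x in unit_leb. norm ((g x - (\<phi> k x + - m k * \<psi> x))\<^sup>2) \<le> (M + ((M + 1) + C * B))\<^sup>2" for k
    proof (rule AE_I2)
      fix x assume "x \<in> space unit_leb"
      then have x: "x \<in> {0..1}" by simp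
      have "\<bar>m k * \<psi> x\<bar> \<le> C * B" unfolding abs_mult using C[of k] \<psi>(3)[of x] C0 by (intro mult_mono) auto
      then have "\<bar>g x - (\<phi> k x + - m k * \<psi> x)\<bar> \<le> M + ((M + 1) + C * B)"
        using M[OF x] \<phi>(2)[OF x, of k] by linarith
      then have "\<bar>g x - (\<phi> k x + - m k * \<psi> x)\<bar>\<^sup>2 \<le> (M + ((M + 1) + C * B))\<^sup>2"
        by (intro power_mono) auto
      then show "norm ((g x - (\<phi> k x + - m k * \<psi> x))\<^sup>2) \<le> (M + ((M + 1) + C * B))\<^sup>2" by simp
    qed
  qed auto
  then have "(\<lambda>k. leb_int 0 1 (\<lambda>x. (g x - (\<phi> k x + - m k * \<psi> x))\<^sup>2)) \<longlonglongrightarrow> 0"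
    by (simp add: leb_int_def)
  then have "\<forall>\<^sub>F k in sequentially. leb_int 0 1 (\<lambda>x. (g x - (\<phi> k x + - m k * \<psi> x))\<^sup>2) < e"
    using e by (rule order_tendstoD)
  then obtain k where k: "leb_int 0 1 (\<lambda>x. (g x - (\<phi> k x + - m k * \<psi> x))\<^sup>2) < e"
    by (meson eventually_happens sequentially_bot)
  have i: "integrable unit_leb (\<phi> k)" "integrable unit_leb \<psi>"
    by (intro L2_integrable C1c_in_L2 \<phi> \<psi>)+
  have "leb_int 0 1 (\<lambda>x. \<phi> k x + - m k * \<psi> x) = leb_int 0 1 (\<phi> k) + - m k * leb_int 0 1 \<psi>"
    using i by (simp add: leb_int_def)
  also have "\<dots> = 0" by (simp add: m_def \<psi>)
  finally have "leb_int 0 1 (\<lambda>x. \<phi> k x + - m k * \<psi> x) = 0" .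
  with k that C1c_lincomb(1)[OF \<phi>(1) \<psi>(1)] show thesis by blast
qed

text \<open>
  The derivative \<open>g\<close> has mean zero, so it is an \<open>L\<^sup>2\<close> limit of test functions with mean zero; their
  primitives are test functions and converge to \<open>v\<close>.
\<close>

lemma H10_graph_piecewise:
  assumes cont: "continuous_on {0..1} v" and bc: "v 0 = 0" "v 1 = 0" and S: "finite S"
    and deriv: "\<And>x. x \<in> {0<..<1} - S \<Longrightarrow> (v has_real_derivative g x) (at x)"
    and M: "\<And>x. x \<in> {0..1} \<Longrightarrow> \<bar>g x\<bar> \<le> M"
  shows "H10_graph v g"
proof -
  have hi: "(g has_integral (v x - v 0)) {0..x}" if "x \<in> {0..1}" for x
    using that S deriv continuous_on_subset[OF cont]
    by (intro fundamental_theorem_of_calculus_interior_strong[of S])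
      (auto simp: has_real_derivative_iff_has_vector_derivative)
  have g: "g \<in> borel_measurable unit_leb"
    using has_integral_implies_lebesgue_measurable_cbox[of g "v 1 - v 0" 0 1] hi[of 1] by simp
  have gL: "g \<in> L2" using g M by (rule L2_bounded)
  have gi: "leb_int 0 x g = v x" if x: "x \<in> {0..1}" for x
  proof -
    have "integrable (lebesgue_on {0..x}) g"
      using integrable_subinterval[of 0 1 g 0 x] L2_integrable[OF gL] x by auto
    then show ?thesis
      using lebesgue_integral_eq_integral[of "{0..x}" g] integral_unique[OF hi[OF x]] bc
      by (simp add: leb_int_def)
  qed
  have "\<exists>\<phi>\<in>C1c. leb_int 0 1 (\<lambda>x. (v x - \<phi> x)\<^sup>2) + leb_int 0 1 (\<lambda>x. (g x - deriv \<phi> x)\<^sup>2) < e"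
    if e: "e > 0" for e
  proof -
    have "e / 2 > 0" using e by simp
    moreover have "leb_int 0 1 g = 0" using gi[of 1] bc by simp
    ultimately obtain \<theta> where \<theta>: "\<theta> \<in> C1c" "leb_int 0 1 \<theta> = 0"
      and small: "leb_int 0 1 (\<lambda>x. (g x - \<theta> x)\<^sup>2) < e / 2"
      using C1c_mean_zero_approximation[OF g M, of "e / 2"] by blast
    obtain F where F: "F \<in> C1c" "\<And>x. (F has_real_derivative \<theta> x) (at x)"
      using C1c_primitive[OF \<theta>] by blast
    have dF: "deriv F = \<theta>" using F(2) by (auto intro: DERIV_imp_deriv)
    have dL: "(\<lambda>x. g x - \<theta> x) \<in> L2" by (intro L2_diff gL C1c_in_L2 \<theta>)
    have pt: "(v x - F x)\<^sup>2 \<le> leb_int 0 1 (\<lambda>x. (g x - \<theta> x)\<^sup>2)" if x: "x \<in> {0..1}" for x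
    proof -
      have i: "integrable (lebesgue_on {0..x}) g" "integrable (lebesgue_on {0..x}) \<theta>"
        using integrable_subinterval[of 0 1 _ 0 x] L2_integrable[OF gL]
          L2_integrable[OF C1c_in_L2(1)[OF \<theta>(1)]] x by auto
      have "leb_int 0 x \<theta> = F x - F 0"
        by (rule leb_int_FTC[where S = "{}"]) (use x i F C1c_derivative in auto)
      then have "v x - F x = leb_int 0 x (\<lambda>x. g x - \<theta> x)"
        using gi[OF x] i C1c_outside[OF F(1), of 0] by (simp add: leb_int_def)
      then show ?thesis using leb_int_subinterval_sq_bound[OF dL x] by simp
    qed
    have "leb_int 0 1 (\<lambda>x. (v x - F x)\<^sup>2) \<le> leb_int 0 1 (\<lambda>y. leb_int 0 1 (\<lambda>x. (g x - \<theta> x)\<^sup>2))"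
      unfolding leb_int_def
      by (rule integral_mono)
        (use pt L2_diff[OF L2_continuous[OF cont] C1c_in_L2(1)[OF F(1)]]
          in \<open>auto simp: L2_def leb_int_def\<close>)
    also have "\<dots> = leb_int 0 1 (\<lambda>x. (g x - \<theta> x)\<^sup>2)" by (simp add: leb_int_def measure_restrict_space)
    finally have "leb_int 0 1 (\<lambda>x. (v x - F x)\<^sup>2) + leb_int 0 1 (\<lambda>x. (g x - deriv F x)\<^sup>2) < e"
      using small by (simp add: dF)
    then show ?thesis using F(1) by blast
  qed
  then show ?thesis using gL L2_continuous[OF cont] by (simp add: H10_graph_def)
qed

lemma leb_int_split:
  assumes "integrable unit_leb f" "0 \<le> a" "a \<le> c" "c \<le> b" "b \<le> 1"
  shows "leb_int a b f = leb_int a c f + leb_int c b f"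
  using Equivalence_Measurable_On_Borel.integral_combine[of a b f c]
    integrable_subinterval[of 0 1 f a b] assms by (auto simp: leb_int_def)

lemma leb_int_cong: "(\<And>x. x \<in> {a..b} \<Longrightarrow> f x = g x) \<Longrightarrow> leb_int a b f = leb_int a b g"
  unfolding leb_int_def by (intro Bochner_Integration.integral_cong) auto

lemma leb_int_restrict:
  assumes "0 \<le> a" "b \<le> 1"
  shows "leb_int 0 1 (\<lambda>x. indicator {a..b} x * f x) = leb_int a b f"
proof -
  have "{a..b} \<inter> {0..1} = {a..b}" using assms by auto
  then have "leb_int 0 1 (\<lambda>x. if x \<in> {a..b} then f x else 0) = leb_int a b f"
    using Lebesgue_Measure.integral_restrict_Int[of "{a..b}" "{0..1}" f]
    by (simp only: leb_int_def sets.sets_into_space lmeasurable_iff_integrable) auto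
  moreover have "(\<lambda>x. indicator {a..b} x * f x) = (\<lambda>x. if x \<in> {a..b} then f x else 0)"
    by (auto simp: fun_eq_iff indicator_def)
  ultimately show ?thesis by simp
qed

lemma L2_integrable_subinterval:
  assumes "f \<in> L2" "0 \<le> a" "b \<le> 1" shows "integrable (lebesgue_on {a..b}) f"
  using integrable_subinterval[of 0 1 f a b] L2_integrable[OF assms(1)] assms by auto

lemma leb_int_ramp:
  assumes g: "g \<in> L2" and ab: "0 \<le> a" "a \<le> b" "b \<le> 1"
  shows "leb_int 0 1 (\<lambda>x. min (b - a) (max 0 (b - x)) * g x)
    = (b - a) * leb_int 0 a g + leb_int a b (\<lambda>x. (b - x) * g x)"
proof -
  let ?r = "\<lambda>x. min (b - a) (max 0 (b - x)) * g x"
  have i: "integrable unit_leb ?r"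
    by (intro integrable_mult_L2 g L2_continuous continuous_intros)
  have "leb_int 0 1 ?r = leb_int 0 a ?r + leb_int a 1 ?r" by (rule leb_int_split) (use i ab in auto)
  also have "leb_int a 1 ?r = leb_int a b ?r + leb_int b 1 ?r" by (rule leb_int_split) (use i ab in auto)
  also have "leb_int 0 a ?r = leb_int 0 a (\<lambda>x. (b - a) * g x)" by (rule leb_int_cong) (use ab in auto)
  also have "leb_int 0 a (\<lambda>x. (b - a) * g x) = (b - a) * leb_int 0 a g" by (simp add: leb_int_def)
  also have "leb_int a b ?r = leb_int a b (\<lambda>x. (b - x) * g x)" by (rule leb_int_cong) (use ab in auto)
  also have "leb_int b 1 ?r = leb_int b 1 (\<lambda>x. 0)" by (rule leb_int_cong) (use ab in auto)
  finally show ?thesis by (simp add: leb_int_def)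
qed

text \<open>
  This is Fubini's theorem for \<open>u(x) = \<integral>\<^sub>0\<^sup>x g\<close>, obtained from test functions by extension. The ramp
  that multiplies \<open>g\<close> is the primitive of minus the indicator of \<open>[a,b]\<close> that vanishes at \<open>1\<close>.
\<close>

lemma H10_graph_integral:
  assumes u: "H10_graph u g" and ab: "0 \<le> a" "a \<le> b" "b \<le> 1"
  shows "leb_int a b u = (b - a) * leb_int 0 a g + leb_int a b (\<lambda>x. (b - x) * g x)"
proof -
  let ?r = "\<lambda>x. min (b - a) (max 0 (b - x))"
  have id: "leb_int 0 1 (\<lambda>x. indicator {a..b} x * \<phi> x) = leb_int 0 1 (\<lambda>x. ?r x * deriv \<phi> x)"
    if \<phi>: "\<phi> \<in> C1c" for \<phi>
  proof -
    have d: "deriv \<phi> \<in> L2" "(\<lambda>x. (b - x) * deriv \<phi> x) \<in> L2" "\<phi> \<in> L2"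
      by (intro L2_continuous continuous_intros C1c_derivative \<phi>)+
    have "leb_int 0 a (deriv \<phi>) = \<phi> a - \<phi> 0"
      by (rule leb_int_FTC[where S = "{}"])
        (use ab C1c_derivative[OF \<phi>] L2_integrable_subinterval[OF d(1)] in auto)
    moreover have "leb_int a b (\<lambda>x. (b - x) * deriv \<phi> x - \<phi> x) = (b - b) * \<phi> b - (b - a) * \<phi> a"
    proof (rule leb_int_FTC[where S = "{}"])
      show "((\<lambda>x. (b - x) * \<phi> x) has_real_derivative (b - x) * deriv \<phi> x - \<phi> x) (at x)" for x
        by (auto intro!: derivative_eq_intros C1c_derivative(1)[OF \<phi>])
      show "continuous_on {a..b} (\<lambda>x. (b - x) * \<phi> x)" by (intro continuous_intros C1c_derivative \<phi>)
      show "integrable (lebesgue_on {a..b}) (\<lambda>x. (b - x) * deriv \<phi> x - \<phi> x)"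
        by (intro L2_integrable_subinterval L2_diff d ab)
    qed (use ab in auto)
    moreover have "leb_int a b (\<lambda>x. (b - x) * deriv \<phi> x - \<phi> x)
        = leb_int a b (\<lambda>x. (b - x) * deriv \<phi> x) - leb_int a b \<phi>"
      using L2_integrable_subinterval[OF d(2)] L2_integrable_subinterval[OF d(3)] ab
      by (simp add: leb_int_def)
    ultimately have "leb_int a b \<phi> = (b - a) * leb_int 0 a (deriv \<phi>) + leb_int a b (\<lambda>x. (b - x) * deriv \<phi> x)"
      using C1c_outside[OF \<phi>, of 0] by simp
    moreover have "leb_int 0 1 (\<lambda>x. indicator {a..b} x * \<phi> x) = leb_int a b \<phi>"
      by (rule leb_int_restrict[OF ab(1,3)])
    ultimately show ?thesis using leb_int_ramp[OF d(1) ab] by simp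
  qed
  have "leb_int a b u = leb_int 0 1 (\<lambda>x. indicator {a..b} x * u x)"
    by (rule leb_int_restrict[OF ab(1,3), symmetric])
  also have "\<dots> = leb_int 0 1 (\<lambda>x. ?r x * g x)"
  proof (rule H10_graph_extend[OF u _ _ id])
    show "indicator {a..b} \<in> L2" by (rule indicator_L2)
    show "?r \<in> L2" by (intro L2_continuous continuous_intros)
  qed auto
  also have "\<dots> = (b - a) * leb_int 0 a g + leb_int a b (\<lambda>x. (b - x) * g x)"
    using u ab by (intro leb_int_ramp) (auto simp: H10_graph_def)
  finally show ?thesis .
qed

lemma H10_graph_mean_zero:
  assumes "H10_graph u g" shows "leb_int 0 1 g = 0"
proof -
  have "leb_int 0 1 (\<lambda>x. 0 * u x) = leb_int 0 1 (\<lambda>x. 1 * g x)"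
  proof (rule H10_graph_extend[OF assms])
    fix \<phi> assume \<phi>: "\<phi> \<in> C1c"
    have "leb_int 0 1 (deriv \<phi>) = \<phi> 1 - \<phi> 0"
      by (rule leb_int_FTC[where S = "{}"])
        (use C1c_derivative[OF \<phi>] L2_integrable[OF C1c_in_L2(2)[OF \<phi>]] in auto)
    then show "leb_int 0 1 (\<lambda>x. 0 * \<phi> x) = leb_int 0 1 (\<lambda>x. 1 * deriv \<phi> x)"
      using C1c_outside[OF \<phi>] by (simp add: leb_int_def)
  qed (rule L2_const)+
  then show ?thesis by (simp add: leb_int_def)
qed

section \<open>The discrete spaces inside the Sobolev space\<close>

lemma mesh_size_pos: "n \<ge> 2 \<Longrightarrow> mesh_size n > 0"
  by (simp add: mesh_size_def)

lemma node_0: "node n 0 = 0" and node_Suc: "node n (Suc k) = node n k + mesh_size n"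
  by (simp_all add: node_def algebra_simps)

lemma node_pred: "k \<ge> 1 \<Longrightarrow> node n (k - 1) = node n k - mesh_size n"
  by (cases k) (simp_all add: node_Suc)

lemma node_n: "n \<ge> 2 \<Longrightarrow> node n n = 1"
  by (simp add: node_def mesh_size_def)

lemma node_mono: "j \<le> k \<Longrightarrow> node n j \<le> node n k"
  by (simp add: node_def mesh_size_def divide_right_mono)

lemma node_le_1: "n \<ge> 2 \<Longrightarrow> k \<le> n \<Longrightarrow> node n k \<le> 1"
  using node_mono[of k n n] by (simp add: node_n)

lemma node_nonneg: "0 \<le> node n k"
  by (simp add: node_def mesh_size_def)

abbreviation cell :: "nat \<Rightarrow> nat \<Rightarrow> real set" where
  "cell n i \<equiv> {node n (i - 1)..node n i}"

text \<open>The two terms cancel at the middle node, where the hat function has no derivative.\<close>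

definition hat_deriv :: "nat \<Rightarrow> nat \<Rightarrow> real \<Rightarrow> real" where
  "hat_deriv n j x = 1 / mesh_size n * indicator (cell n j) x
     - 1 / mesh_size n * indicator (cell n (Suc j)) x"

lemma H10_graph_hat:
  assumes n: "n \<ge> 2" and j: "j \<in> {1..n - 1}"
  shows "H10_graph (hat n j) (hat_deriv n j)"
proof (rule H10_graph_piecewise[where S = "{node n (j - 1), node n j, node n (Suc j)}"
      and M = "1 / mesh_size n"])
  define h where "h = mesh_size n"
  define a where "a = node n j"
  have h: "h > 0" using mesh_size_pos[OF n] by (simp add: h_def)
  have nd: "node n (j - 1) = a - h" "node n (Suc j) = a + h"
    using j node_pred[of j n] by (auto simp: a_def h_def node_Suc)
  have hat: "hat n j = (\<lambda>x. max 0 (1 - \<bar>x - a\<bar> / h))" by (simp add: fun_eq_iff hat_def a_def h_def)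
  have hd: "hat_deriv n j = (\<lambda>x. 1 / h * indicator {a - h..a} x - 1 / h * indicator {a..a + h} x)"
    by (rule ext) (simp only: hat_deriv_def nd a_def[symmetric] h_def[symmetric] diff_Suc_1)
  show "continuous_on {0..1} (hat n j)" unfolding hat by (intro continuous_intros) (use h in auto)
  show "hat n j 0 = 0" using hat_nodal[OF n, of j 0] j by (simp add: node_0)
  have "j \<noteq> n" using j n by auto
  then show "hat n j 1 = 0" using hat_nodal[OF n, of j n] n by (simp add: node_n)
  show "\<bar>hat_deriv n j x\<bar> \<le> 1 / mesh_size n" if "x \<in> {0..1}" for x
    unfolding hd h_def[symmetric] using h by (auto simp: indicator_def)
  show "(hat n j has_real_derivative hat_deriv n j x) (at x)"
    if x: "x \<in> {0<..<1} - {node n (j - 1), node n j, node n (Suc j)}" for x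
  proof -
    consider "x < a - h" | "a - h < x" "x < a" | "a < x" "x < a + h" | "a + h < x"
      using x nd a_def by fastforce
    then show ?thesis
    proof cases
      case 1
      have "((\<lambda>x. 0) has_real_derivative hat_deriv n j x) (at x)" using 1 h by (simp add: hd)
      then show ?thesis
        by (rule has_field_derivative_transform_within_open[where S = "{..<a - h}"])
          (use 1 h in \<open>auto simp: hat field_simps\<close>)
    next
      case 2
      have "((\<lambda>x. 1 + (x - a) / h) has_real_derivative hat_deriv n j x) (at x)"
        using 2 h by (auto simp: hd intro!: derivative_eq_intros)
      then show ?thesis
        by (rule has_field_derivative_transform_within_open[where S = "{a - h<..<a}"])
          (use 2 h in \<open>auto simp: hat field_simps\<close>)
    next
      case 3
      have "((\<lambda>x. 1 - (x - a) / h) has_real_derivative hat_deriv n j x) (at x)"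
        using 3 h by (auto simp: hd intro!: derivative_eq_intros)
      then show ?thesis
        by (rule has_field_derivative_transform_within_open[where S = "{a<..<a + h}"])
          (use 3 h in \<open>auto simp: hat field_simps\<close>)
    next
      case 4
      have "((\<lambda>x. 0) has_real_derivative hat_deriv n j x) (at x)" using 4 h by (simp add: hd)
      then show ?thesis
        by (rule has_field_derivative_transform_within_open[where S = "{a + h<..}"])
          (use 4 h in \<open>auto simp: hat field_simps\<close>)
    qed
  qed
qed auto

lemma H10_graph_zero: "H10_graph (\<lambda>x. 0) (\<lambda>x. 0)"
  by (rule H10_graph_piecewise[where S = "{}" and M = 0]) auto

lemma H10_graph_trial:
  assumes n: "n \<ge> 2"
  shows "H10_graph (\<lambda>x. \<Sum>j=1..n-1. c j * hat n j x) (\<lambda>x. \<Sum>j=1..n-1. c j * hat_deriv n j x)"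
proof -
  have "H10_graph (\<lambda>x. \<Sum>j\<in>J. c j * hat n j x) (\<lambda>x. \<Sum>j\<in>J. c j * hat_deriv n j x)"
    if "finite J" "J \<subseteq> {1..n - 1}" for J
    using that
  proof (induction J)
    case empty
    then show ?case by (simp add: H10_graph_zero)
  next
    case (insert j J)
    have "H10_graph (\<lambda>x. (\<Sum>j\<in>J. c j * hat n j x) + c j * hat n j x)
        (\<lambda>x. (\<Sum>j\<in>J. c j * hat_deriv n j x) + c j * hat_deriv n j x)"
      using insert by (intro H10_graph_lincomb H10_graph_hat n) auto
    then show ?case using insert by (simp add: add.commute)
  qed
  then show ?thesis by blast
qed

text \<open>Equal to \<open>1 / (1 - exp (- h / \<epsilon>))\<close>, and therefore greater than \<open>1\<close>.\<close>

definition exp_coeff :: "real \<Rightarrow> nat \<Rightarrow> real" where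
  "exp_coeff \<epsilon> n = (1 + g0 \<epsilon> n) / (2 * g0 \<epsilon> n)"

lemma g0_bounds:
  assumes "\<epsilon> > 0" "n \<ge> 2" shows "0 < g0 \<epsilon> n" "g0 \<epsilon> n < 1"
  using assms mesh_size_pos[of n] by (auto simp: g0_def tanh_real_lt_1)

lemma exp_coeff_gt_1: "\<epsilon> > 0 \<Longrightarrow> n \<ge> 2 \<Longrightarrow> exp_coeff \<epsilon> n > 1"
  using g0_bounds[of \<epsilon> n] by (simp add: exp_coeff_def field_simps)

definition elem_bubble_deriv :: "real \<Rightarrow> nat \<Rightarrow> nat \<Rightarrow> real \<Rightarrow> real" where
  "elem_bubble_deriv \<epsilon> n i x = indicator (cell n i) x *
     (exp_coeff \<epsilon> n / \<epsilon> * exp (- (x - node n (i - 1)) / \<epsilon>) - 1 / mesh_size n)"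

lemma H10_graph_elem_bubble:
  assumes e: "\<epsilon> > 0" and n: "n \<ge> 2" and i: "i \<in> {1..n}"
  shows "H10_graph (elem_bubble \<epsilon> n i) (elem_bubble_deriv \<epsilon> n i)"
proof (rule H10_graph_piecewise[where S = "{node n (i - 1), node n i}"
      and M = "exp_coeff \<epsilon> n / \<epsilon> + 1 / mesh_size n"])
  define h where "h = mesh_size n"
  define a where "a = node n (i - 1)"
  define A where "A = exp_coeff \<epsilon> n"
  have h: "h > 0" using mesh_size_pos[OF n] by (simp add: h_def)
  have A: "A > 1" using exp_coeff_gt_1[OF e n] by (simp add: A_def)
  have nd: "node n i = a + h" using i node_pred[of i n] by (auto simp: a_def h_def)
  have b: "bubble \<epsilon> n = (\<lambda>x. A * (1 - exp (- x / \<epsilon>)) - x / h)"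
    by (simp add: fun_eq_iff bubble_def A_def exp_coeff_def h_def)
  have bc: "bubble \<epsilon> n 0 = 0" "bubble \<epsilon> n h = 0"
    using bubble_boundary_value_problem(1,2)[OF e n] by (auto simp: h_def)
  \<comment> \<open>The bubble vanishes at both ends of the cell, so its extension by zero arises by clamping the
    argument; this form is visibly continuous.\<close>
  have clamp: "elem_bubble \<epsilon> n i = (\<lambda>x. bubble \<epsilon> n (min h (max 0 (x - a))))"
  proof
    fix x
    consider "x < a" | "x > a + h" | "x = a + h" | "a \<le> x" "x < a + h" by fastforce
    then show "elem_bubble \<epsilon> n i x = bubble \<epsilon> n (min h (max 0 (x - a)))"
      unfolding elem_bubble_def nd a_def[symmetric] by cases (use h bc in \<open>auto simp: min_def max_def\<close>)
  qed
  have bd: "elem_bubble_deriv \<epsilon> n i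
      = (\<lambda>x. indicator {a..a + h} x * (A / \<epsilon> * exp (- (x - a) / \<epsilon>) - 1 / h))"
    by (rule ext) (simp only: elem_bubble_deriv_def nd a_def[symmetric] A_def[symmetric] h_def[symmetric])
  show "continuous_on {0..1} (elem_bubble \<epsilon> n i)"
    unfolding clamp b by (intro continuous_intros) (use h e in auto)
  have "a \<ge> 0" by (simp add: a_def node_nonneg)
  then show "elem_bubble \<epsilon> n i 0 = 0" using h bc by (simp add: clamp)
  have "a + h \<le> 1" using node_le_1[OF n, of i] i nd by simp
  then show "elem_bubble \<epsilon> n i 1 = 0" using h bc by (simp add: clamp)
  show "\<bar>elem_bubble_deriv \<epsilon> n i x\<bar> \<le> exp_coeff \<epsilon> n / \<epsilon> + 1 / mesh_size n" if "x \<in> {0..1}" for x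
  proof (cases "x \<in> {a..a + h}")
    case True
    have "0 \<le> A / \<epsilon> * exp (- (x - a) / \<epsilon>)" using A e by simp
    moreover have "A / \<epsilon> * exp (- (x - a) / \<epsilon>) \<le> A / \<epsilon> * 1"
      using A e True by (intro mult_left_mono) (auto simp: divide_nonpos_pos)
    ultimately have "\<bar>A / \<epsilon> * exp (- (x - a) / \<epsilon>) - 1 / h\<bar> \<le> A / \<epsilon> + 1 / h"
      using h unfolding abs_le_iff by (smt (verit) divide_pos_pos mult.right_neutral)
    then show ?thesis using True by (simp add: bd A_def h_def)
  next
    case False
    then show ?thesis using A e h by (simp add: bd A_def[symmetric] h_def[symmetric])
  qed
  show "(elem_bubble \<epsilon> n i has_real_derivative elem_bubble_deriv \<epsilon> n i x) (at x)"
    if x: "x \<in> {0<..<1} - {node n (i - 1), node n i}" for x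
  proof -
    consider "x < a" | "a < x" "x < a + h" | "a + h < x"
      using x nd a_def by fastforce
    then show ?thesis
    proof cases
      case 1
      have "((\<lambda>x. 0) has_real_derivative elem_bubble_deriv \<epsilon> n i x) (at x)" using 1 by (simp add: bd)
      then show ?thesis
        by (rule has_field_derivative_transform_within_open[where S = "{..<a}"])
          (use 1 h bc in \<open>auto simp: clamp\<close>)
    next
      case 2
      have "((\<lambda>x. A * (1 - exp (- (x - a) / \<epsilon>)) - (x - a) / h) has_real_derivative
          elem_bubble_deriv \<epsilon> n i x) (at x)"
        using 2 h e by (auto simp: bd intro!: derivative_eq_intros)
      then show ?thesis
      proof (rule has_field_derivative_transform_within_open[where S = "{a<..<a + h}"])
        fix y assume "y \<in> {a<..<a + h}"
        then have "min h (max 0 (y - a)) = y - a" by auto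
        then show "A * (1 - exp (- (y - a) / \<epsilon>)) - (y - a) / h = elem_bubble \<epsilon> n i y"
          unfolding clamp b by (simp only:)
      qed (use 2 in auto)
    next
      case 3
      have "((\<lambda>x. 0) has_real_derivative elem_bubble_deriv \<epsilon> n i x) (at x)" using 3 by (simp add: bd)
      then show ?thesis
        by (rule has_field_derivative_transform_within_open[where S = "{a + h<..}"])
          (use 3 h bc in \<open>auto simp: clamp\<close>)
    qed
  qed
qed auto

definition test_fun :: "real \<Rightarrow> nat \<Rightarrow> nat \<Rightarrow> real \<Rightarrow> real" where
  "test_fun \<epsilon> n j x = hat n j x + (elem_bubble \<epsilon> n j x - elem_bubble \<epsilon> n (j + 1) x)"

definition test_fun_deriv :: "real \<Rightarrow> nat \<Rightarrow> nat \<Rightarrow> real \<Rightarrow> real" where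
  "test_fun_deriv \<epsilon> n j x =
     hat_deriv n j x + (elem_bubble_deriv \<epsilon> n j x - elem_bubble_deriv \<epsilon> n (j + 1) x)"

lemma H10_graph_test_fun:
  assumes "\<epsilon> > 0" "n \<ge> 2" "j \<in> {1..n - 1}"
  shows "H10_graph (test_fun \<epsilon> n j) (test_fun_deriv \<epsilon> n j)"
proof -
  have "H10_graph (\<lambda>x. (hat n j x + 1 * elem_bubble \<epsilon> n j x) + -1 * elem_bubble \<epsilon> n (j + 1) x)
     (\<lambda>x. (hat_deriv n j x + 1 * elem_bubble_deriv \<epsilon> n j x) + -1 * elem_bubble_deriv \<epsilon> n (j + 1) x)"
    using assms by (intro H10_graph_lincomb H10_graph_hat H10_graph_elem_bubble) auto
  moreover have "(\<lambda>x. (hat n j x + 1 * elem_bubble \<epsilon> n j x) + -1 * elem_bubble \<epsilon> n (j + 1) x) = test_fun \<epsilon> n j"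
    "(\<lambda>x. (hat_deriv n j x + 1 * elem_bubble_deriv \<epsilon> n j x) + -1 * elem_bubble_deriv \<epsilon> n (j + 1) x) = test_fun_deriv \<epsilon> n j"
    by (auto simp: fun_eq_iff test_fun_def test_fun_deriv_def)
  ultimately show ?thesis by simp
qed

lemma test_fun_in_test_space:
  assumes "j \<in> {1..n - 1}" shows "test_fun \<epsilon> n j \<in> test_space \<epsilon> n"
proof -
  have "test_fun \<epsilon> n j = (\<lambda>x. \<Sum>i=1..n-1. (if i = j then 1 else 0) *
      (hat n i x + (elem_bubble \<epsilon> n i x - elem_bubble \<epsilon> n (i + 1) x)))"
    using assms by (auto simp: fun_eq_iff test_fun_def if_distrib[of "\<lambda>c. c * _"] cong: if_cong)
  then show ?thesis unfolding test_space_def by (intro CollectI exI[of _ "\<lambda>i. if i = j then 1 else 0"])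
qed

text \<open>
  The left half of the test function is \<open>A (1 - exp (- s / \<epsilon>))\<close> and the right half is
  \<open>1 - A (1 - exp (- s / \<epsilon>))\<close>, where \<open>s\<close> is the distance to the left end of the cell and \<open>A\<close> is
  \<^const>\<open>exp_coeff\<close>: the linear part of the bubble cancels the slope of the hat. Both halves solve the
  homogeneous adjoint equation, and the constants \<open>A\<close> and \<open>1 - A\<close> can be read off.
\<close>

lemma test_fun_flux:
  assumes e: "\<epsilon> > 0" and n: "n \<ge> 2" and j: "j \<in> {1..n - 1}"
    and x: "x \<notin> {node n (j - 1), node n j, node n (Suc j)}"
  shows "\<epsilon> * test_fun_deriv \<epsilon> n j x + test_fun \<epsilon> n j x
    = exp_coeff \<epsilon> n * indicator (cell n j) x + (1 - exp_coeff \<epsilon> n) * indicator (cell n (Suc j)) x"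
proof -
  define h where "h = mesh_size n"
  define a where "a = node n j"
  define A where "A = exp_coeff \<epsilon> n"
  have h: "h > 0" using mesh_size_pos[OF n] by (simp add: h_def)
  have nd: "node n (j - 1) = a - h" "node n (Suc j) = a + h"
    using j node_pred[of j n] by (auto simp: a_def h_def node_Suc)
  have s: "j + 1 - 1 = j" "j + 1 = Suc j" "Suc j - 1 = j" by auto
  have v: "test_fun \<epsilon> n j x = max 0 (1 - \<bar>x - a\<bar> / h)
      + ((if x \<in> {a - h..a} then A * (1 - exp (- (x - (a - h)) / \<epsilon>)) - (x - (a - h)) / h else 0)
       - (if x \<in> {a..a + h} then A * (1 - exp (- (x - a) / \<epsilon>)) - (x - a) / h else 0))"
    unfolding test_fun_def hat_def elem_bubble_def bubble_def s nd a_def[symmetric] h_def[symmetric]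
      A_def exp_coeff_def ..
  have q: "test_fun_deriv \<epsilon> n j x
      = (1 / h * indicator {a - h..a} x - 1 / h * indicator {a..a + h} x)
      + (indicator {a - h..a} x * (A / \<epsilon> * exp (- (x - (a - h)) / \<epsilon>) - 1 / h)
       - indicator {a..a + h} x * (A / \<epsilon> * exp (- (x - a) / \<epsilon>) - 1 / h))"
    unfolding test_fun_deriv_def hat_deriv_def elem_bubble_deriv_def s nd a_def[symmetric]
      h_def[symmetric] A_def ..
  consider "x < a - h" | "a - h < x" "x < a" | "a < x" "x < a + h" | "a + h < x"
    using x nd a_def by fastforce
  then have "\<epsilon> * test_fun_deriv \<epsilon> n j x + test_fun \<epsilon> n j x
      = A * indicator {a - h..a} x + (1 - A) * indicator {a..a + h} x"
    unfolding v q by cases (use h e in \<open>simp_all add: max_def field_simps\<close>)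
  then show ?thesis unfolding s nd a_def[symmetric] A_def .
qed

section \<open>Galerkin orthogonality and the increments over the cells\<close>

definition incr :: "nat \<Rightarrow> (real \<Rightarrow> real) \<Rightarrow> nat \<Rightarrow> real" where
  "incr n w i = leb_int (node n (i - 1)) (node n i) w"

lemma leb_int_wderiv_cong:
  assumes "H10_graph u g" "a \<in> L2"
  shows "leb_int 0 1 (\<lambda>x. wderiv u x * a x) = leb_int 0 1 (\<lambda>x. g x * a x)"
proof (rule leb_int_cong_AE)
  show "AE x in unit_leb. wderiv u x * a x = g x * a x"
    using wderiv_AE_eq[OF H10_graph_weak_deriv[OF assms(1)]] by eventually_elim simp
  have "wderiv u \<in> L2"
    using is_weak_deriv_wderiv[OF H10_graph_weak_deriv[OF assms(1)]] by (simp add: is_weak_deriv_def)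
  then show "(\<lambda>x. wderiv u x * a x) \<in> borel_measurable unit_leb"
    "(\<lambda>x. g x * a x) \<in> borel_measurable unit_leb"
    using assms by (auto simp: H10_graph_def L2_def)
qed

lemma bform_graph:
  assumes "H10_graph u w" "H10_graph v q"
  shows "bform \<epsilon> v u = leb_int 0 1 (\<lambda>x. w x * (\<epsilon> * q x + v x))"
proof -
  have L: "w \<in> L2" "v \<in> L2" "q \<in> L2" using assms by (auto simp: H10_graph_def)
  have "wderiv v \<in> L2"
    using is_weak_deriv_wderiv[OF H10_graph_weak_deriv[OF assms(2)]] by (simp add: is_weak_deriv_def)
  then have "leb_int 0 1 (\<lambda>x. wderiv u x * wderiv v x) = leb_int 0 1 (\<lambda>x. wderiv v x * w x)"
    using leb_int_wderiv_cong[OF assms(1)] by (simp add: mult.commute[of "wderiv v _"])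
  also have "\<dots> = leb_int 0 1 (\<lambda>x. w x * q x)"
    using leb_int_wderiv_cong[OF assms(2) L(1)] by (simp add: mult.commute[of "w _"])
  finally have "bform \<epsilon> v u = \<epsilon> * leb_int 0 1 (\<lambda>x. w x * q x) + leb_int 0 1 (\<lambda>x. w x * v x)"
    using leb_int_wderiv_cong[OF assms(1) L(2)] by (simp add: bform_def)
  also have "\<dots> = leb_int 0 1 (\<lambda>x. w x * (\<epsilon> * q x + v x))"
    using integrable_mult_L2[OF L(1,2)] integrable_mult_L2[OF L(1,3)]
    by (simp add: leb_int_def distrib_left mult.left_commute)
  finally show ?thesis .
qed

lemma leb_int_two_cells:
  assumes n: "n \<ge> 2" and j: "j \<in> {1..n - 1}" and w: "w \<in> L2"
  shows "leb_int 0 1 (\<lambda>x. w x * (\<alpha> * indicator (cell n j) x + \<beta> * indicator (cell n (Suc j)) x))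
    = \<alpha> * incr n w j + \<beta> * incr n w (Suc j)"
proof -
  have i: "integrable unit_leb (\<lambda>x. indicator {a..b} x * w x)" for a b
    by (intro integrable_mult_L2 indicator_L2 w)
  have "leb_int 0 1 (\<lambda>x. w x * (\<alpha> * indicator (cell n j) x + \<beta> * indicator (cell n (Suc j)) x))
    = leb_int 0 1 (\<lambda>x. \<alpha> * (indicator (cell n j) x * w x) + \<beta> * (indicator (cell n (Suc j)) x * w x))"
    by (rule leb_int_cong) (simp add: algebra_simps)
  also have "\<dots> = \<alpha> * leb_int 0 1 (\<lambda>x. indicator (cell n j) x * w x)
      + \<beta> * leb_int 0 1 (\<lambda>x. indicator (cell n (Suc j)) x * w x)"
    using i by (simp add: leb_int_def)
  also have "leb_int 0 1 (\<lambda>x. indicator (cell n j) x * w x) = incr n w j"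
    unfolding incr_def by (rule leb_int_restrict) (use n j in \<open>auto simp: node_nonneg intro: node_le_1\<close>)
  also have "leb_int 0 1 (\<lambda>x. indicator (cell n (Suc j)) x * w x) = incr n w (Suc j)"
    unfolding incr_def by (rule leb_int_restrict) (use n j in \<open>auto simp: node_nonneg intro!: node_le_1\<close>)
  finally show ?thesis .
qed

lemma bform_test_fun:
  assumes e: "\<epsilon> > 0" and n: "n \<ge> 2" and j: "j \<in> {1..n - 1}" and u: "H10_graph u w"
  shows "bform \<epsilon> (test_fun \<epsilon> n j) u
    = exp_coeff \<epsilon> n * incr n w j + (1 - exp_coeff \<epsilon> n) * incr n w (Suc j)"
proof -
  have w: "w \<in> L2" using u by (simp add: H10_graph_def)
  have tL: "test_fun \<epsilon> n j \<in> L2" "test_fun_deriv \<epsilon> n j \<in> L2"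
    using H10_graph_test_fun[OF e n j] by (auto simp: H10_graph_def)
  let ?k = "\<lambda>x. exp_coeff \<epsilon> n * indicator (cell n j) x + (1 - exp_coeff \<epsilon> n) * indicator (cell n (Suc j)) x"
  have "bform \<epsilon> (test_fun \<epsilon> n j) u = leb_int 0 1 (\<lambda>x. w x * (\<epsilon> * test_fun_deriv \<epsilon> n j x + test_fun \<epsilon> n j x))"
    by (rule bform_graph[OF u H10_graph_test_fun[OF e n j]])
  also have "\<dots> = leb_int 0 1 (\<lambda>x. w x * ?k x)"
  proof (rule leb_int_cong_AE)
    have "AE x in unit_leb. x \<notin> {node n (j - 1), node n j, node n (Suc j)}"
      by (intro AE_unit_leb_not_in) simp
    then show "AE x in unit_leb. w x * (\<epsilon> * test_fun_deriv \<epsilon> n j x + test_fun \<epsilon> n j x) = w x * ?k x"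
      by eventually_elim (subst test_fun_flux[OF e n j], auto)
    show "(\<lambda>x. w x * (\<epsilon> * test_fun_deriv \<epsilon> n j x + test_fun \<epsilon> n j x)) \<in> borel_measurable unit_leb"
      using w tL by (intro borel_measurable_integrable integrable_mult_L2 L2_add L2_scale)
    show "(\<lambda>x. w x * ?k x) \<in> borel_measurable unit_leb"
      using w by (intro borel_measurable_integrable integrable_mult_L2 L2_add L2_scale indicator_L2)
  qed
  also have "\<dots> = exp_coeff \<epsilon> n * incr n w j + (1 - exp_coeff \<epsilon> n) * incr n w (Suc j)"
    by (rule leb_int_two_cells[OF n j w])
  finally show ?thesis .
qed

lemma leb_int_partition:
  assumes "integrable unit_leb f" "n \<ge> 2" "k \<le> n"
  shows "leb_int 0 (node n k) f = (\<Sum>i=1..k. leb_int (node n (i - 1)) (node n i) f)"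
  using assms(3)
proof (induction k)
  case 0
  have "leb_int 0 0 f = leb_int 0 0 f + leb_int 0 0 f"
    by (rule leb_int_split) (use assms in auto)
  then show ?case by (simp add: node_0)
next
  case (Suc k)
  have "leb_int 0 (node n (Suc k)) f = leb_int 0 (node n k) f + leb_int (node n k) (node n (Suc k)) f"
    by (rule leb_int_split)
      (use assms(1,2) Suc.prems in \<open>auto simp: node_nonneg intro: node_mono node_le_1\<close>)
  then show ?case using Suc by simp
qed

text \<open>
  The recurrence makes \<open>G\<close> a geometric sequence with the ratio \<open>A / (A - 1)\<close>, which is positive, so
  the terms have a common sign and cannot cancel in the sum.
\<close>

lemma recurrence_mean_zero_imp_zero:
  fixes G :: "nat \<Rightarrow> real"
  assumes A: "A > 1" and rec: "\<And>j. j \<in> {1..n - 1} \<Longrightarrow> A * G j + (1 - A) * G (Suc j) = 0"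
    and sum: "(\<Sum>i=1..n. G i) = 0" and i: "i \<in> {1..n}"
  shows "G i = 0"
proof -
  define r where "r = A / (A - 1)"
  have r: "r > 0" using A by (simp add: r_def)
  have pow: "G (Suc k) = r ^ k * G 1" if "Suc k \<le> n" for k
    using that
  proof (induction k)
    case (Suc k)
    have "(A - 1) * G (Suc (Suc k)) = A * G (Suc k)" using rec[of "Suc k"] Suc.prems by (simp add: algebra_simps)
    then have "G (Suc (Suc k)) = r * G (Suc k)" using A by (simp add: r_def field_simps)
    moreover have "G (Suc k) = r ^ k * G 1" using Suc by simp
    ultimately show ?case by (simp only: power_Suc mult.assoc)
  qed simp
  have "0 = (\<Sum>k<n. G (Suc k))" using sum by (simp add: sum.atLeast1_atMost_eq)
  also have "\<dots> = (\<Sum>k<n. r ^ k * G 1)" by (intro sum.cong pow) auto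
  also have "\<dots> = (\<Sum>k<n. r ^ k) * G 1" by (rule sum_distrib_right[symmetric])
  finally have "(\<Sum>k<n. r ^ k) * G 1 = 0" by simp
  moreover have "(\<Sum>k<n. r ^ k) > 0"
  proof (rule sum_pos)
    show "{..<n} \<noteq> {}" using i by (simp add: lessThan_empty_iff)
  qed (use r in auto)
  ultimately have "G 1 = 0" by simp
  moreover have "G i = r ^ (i - 1) * G 1" using pow[of "i - 1"] i by simp
  ultimately show ?thesis by (simp only: mult_zero_right)
qed

text \<open>
  Each basis function of the test space couples the increments of the error over two neighbouring
  cells, which is exactly the recurrence above; the mean vanishes by the boundary conditions.
\<close>

lemma Petrov_Galerkin_error_increments:
  assumes e: "\<epsilon> > 0" and n: "n \<ge> 2" and u: "H10_graph u w" and p: "H10_graph p r"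
    and orth: "\<forall>v\<in>H10. bform \<epsilon> v u = L2_inner f v" "\<forall>v\<in>test_space \<epsilon> n. bform \<epsilon> v p = L2_inner f v"
    and i: "i \<in> {1..n}"
  shows "incr n (\<lambda>x. w x - r x) i = 0"
proof (rule recurrence_mean_zero_imp_zero[where A = "exp_coeff \<epsilon> n" and n = n])
  have up: "H10_graph (\<lambda>x. u x - p x) (\<lambda>x. w x - r x)"
    using H10_graph_lincomb[OF u p, of "-1"] by simp
  have L: "w \<in> L2" "r \<in> L2" using u p by (auto simp: H10_graph_def)
  have diff: "incr n (\<lambda>x. w x - r x) k = incr n w k - incr n r k" if "k \<le> n" for k
    using L2_integrable_subinterval[OF L(1), of "node n (k - 1)" "node n k"]
      L2_integrable_subinterval[OF L(2), of "node n (k - 1)" "node n k"] node_nonneg node_le_1[OF n that]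
    by (simp add: incr_def leb_int_def)
  show "exp_coeff \<epsilon> n > 1" by (rule exp_coeff_gt_1[OF e n])
  show "exp_coeff \<epsilon> n * incr n (\<lambda>x. w x - r x) j + (1 - exp_coeff \<epsilon> n) * incr n (\<lambda>x. w x - r x) (Suc j) = 0"
    if j: "j \<in> {1..n - 1}" for j
  proof -
    have "test_fun \<epsilon> n j \<in> H10" using H10_graph_test_fun[OF e n j] H10_iff_graph by blast
    then have "bform \<epsilon> (test_fun \<epsilon> n j) u = bform \<epsilon> (test_fun \<epsilon> n j) p"
      using orth test_fun_in_test_space[OF j] by simp
    moreover have "j \<le> n" "Suc j \<le> n" using j n by auto
    ultimately show ?thesis
      unfolding bform_test_fun[OF e n j u] bform_test_fun[OF e n j p] \<open>j \<le> n\<close>[THEN diff]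
        \<open>Suc j \<le> n\<close>[THEN diff] by (simp add: algebra_simps)
  qed
  show "(\<Sum>i=1..n. incr n (\<lambda>x. w x - r x) i) = 0"
    using leb_int_partition[OF L2_integrable[OF L2_diff[OF L]] n, of n] H10_graph_mean_zero[OF up]
    by (simp add: incr_def node_n[OF n])
qed (rule i)

lemma trial_deriv_orthogonal:
  assumes n: "n \<ge> 2" and w: "w \<in> L2" and zero: "\<And>i. i \<in> {1..n} \<Longrightarrow> incr n w i = 0"
  shows "leb_int 0 1 (\<lambda>x. w x * (\<Sum>j=1..n-1. c j * hat_deriv n j x)) = 0"
proof -
  have hL: "hat_deriv n j \<in> L2" for j
    unfolding hat_deriv_def[abs_def] by (intro L2_diff L2_scale indicator_L2)
  have i: "integrable unit_leb (\<lambda>x. c j * (w x * hat_deriv n j x))" for j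
    using integrable_mult_L2[OF w hL[of j]] by simp
  have z: "leb_int 0 1 (\<lambda>x. w x * hat_deriv n j x) = 0" if j: "j \<in> {1..n - 1}" for j
  proof -
    have "incr n w j = 0" "incr n w (Suc j) = 0" using j n by (auto intro!: zero)
    then show ?thesis
      using leb_int_two_cells[OF n j w, of "1 / mesh_size n" "- (1 / mesh_size n)"]
      by (simp add: hat_deriv_def)
  qed
  have "leb_int 0 1 (\<lambda>x. w x * (\<Sum>j=1..n-1. c j * hat_deriv n j x))
      = leb_int 0 1 (\<lambda>x. \<Sum>j=1..n-1. c j * (w x * hat_deriv n j x))"
    by (rule leb_int_cong) (simp add: sum_distrib_left mult.left_commute)
  also have "\<dots> = (\<Sum>j=1..n-1. leb_int 0 1 (\<lambda>x. c j * (w x * hat_deriv n j x)))"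
    unfolding leb_int_def using i by (intro Bochner_Integration.integral_sum) auto
  also have "\<dots> = 0" by (intro sum.neutral) (use z in \<open>auto simp: leb_int_def\<close>)
  finally show ?thesis .
qed

lemma H10_norm_sq_graph:
  assumes "H10_graph u w" shows "H10_norm_sq u = leb_int 0 1 (\<lambda>x. (w x)\<^sup>2)"
proof -
  have "wderiv u \<in> L2"
    using is_weak_deriv_wderiv[OF H10_graph_weak_deriv[OF assms]] by (simp add: is_weak_deriv_def)
  moreover have "w \<in> L2" using assms by (simp add: H10_graph_def)
  moreover have "AE x in unit_leb. (wderiv u x)\<^sup>2 = (w x)\<^sup>2"
    using wderiv_AE_eq[OF H10_graph_weak_deriv[OF assms]] by eventually_elim simp
  ultimately show ?thesis
    unfolding H10_norm_sq_def by (intro leb_int_cong_AE) (auto simp: L2_def)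
qed

text \<open>Pythagoras, because \<open>w\<close> is orthogonal to the derivatives of the trial functions.\<close>

lemma error_energy_minimal:
  assumes n: "n \<ge> 2" and e: "H10_graph e w" and zero: "\<And>i. i \<in> {1..n} \<Longrightarrow> incr n w i = 0"
    and p: "p \<in> trial_space n"
  shows "H10_norm_sq e \<le> H10_norm_sq (\<lambda>x. e x + p x)"
proof -
  obtain c where c: "p = (\<lambda>x. \<Sum>j=1..n-1. c j * hat n j x)" using p by (auto simp: trial_space_def)
  define r where "r = (\<lambda>x. \<Sum>j=1..n-1. c j * hat_deriv n j x)"
  have pr: "H10_graph p r" unfolding c r_def by (rule H10_graph_trial[OF n])
  have L: "w \<in> L2" "r \<in> L2" using e pr by (auto simp: H10_graph_def)
  have "H10_graph (\<lambda>x. e x + p x) (\<lambda>x. w x + r x)" using H10_graph_lincomb[OF e pr, of 1] by simp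
  then have "H10_norm_sq (\<lambda>x. e x + p x) = leb_int 0 1 (\<lambda>x. (w x + r x)\<^sup>2)" by (rule H10_norm_sq_graph)
  also have "\<dots> = leb_int 0 1 (\<lambda>x. (w x)\<^sup>2 + 2 * (w x * r x) + (r x)\<^sup>2)"
    by (rule leb_int_cong) (simp add: power2_sum)
  also have "\<dots> = leb_int 0 1 (\<lambda>x. (w x)\<^sup>2) + 2 * leb_int 0 1 (\<lambda>x. w x * r x) + leb_int 0 1 (\<lambda>x. (r x)\<^sup>2)"
    using L2D(2)[OF L(1)] L2D(2)[OF L(2)] integrable_mult_L2[OF L] by (simp add: leb_int_def)
  also have "leb_int 0 1 (\<lambda>x. w x * r x) = 0"
    unfolding r_def by (rule trial_deriv_orthogonal[OF n L(1) zero])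
  finally show ?thesis
    using leb_int_square_nonneg[of 0 1 r] by (simp add: H10_norm_sq_graph[OF e])
qed

section \<open>Bounds for the seminorm of cell means\<close>

text \<open>The seminorm is the variance of the cell means, all cells having the weight \<open>1 / n\<close>.\<close>

lemma star_seminorm_sq_nonneg:
  assumes n: "n \<ge> 2" and u: "u \<in> L2"
  shows "0 \<le> star_seminorm_sq n u"
proof -
  define m where "m i = leb_int (node n (i - 1)) (node n i) u" for i
  have "leb_int 0 1 u = (\<Sum>i=1..n. m i)"
    using leb_int_partition[OF L2_integrable[OF u] n, of n] by (simp add: m_def node_n[OF n])
  moreover have "(\<Sum>i=1..n. m i * 1)\<^sup>2 \<le> (\<Sum>i=1..n. (m i)\<^sup>2) * (\<Sum>i=1..n. 1\<^sup>2)"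
    by (rule Cauchy_Schwarz_ineq_sum)
  moreover have "1 / real n * (\<Sum>i=1..n. (1 / mesh_size n * m i)\<^sup>2) = real n * (\<Sum>i=1..n. (m i)\<^sup>2)"
    using n by (simp add: mesh_size_def power_mult_distrib sum_distrib_left[symmetric] power2_eq_square[of "real n"])
  ultimately show ?thesis by (simp add: star_seminorm_sq_def m_def mult.commute)
qed

text \<open>
  As the increments of \<open>e\<close> vanish, the integral of \<open>e\<close> over the cell is that of \<open>(b - x) e'(x)\<close>, where
  \<open>b\<close> is the right end point and may be replaced by any constant. The midpoint \<open>m\<close> minimizes the
  integral of \<open>(m - x)\<^sup>2\<close>, which is then \<open>h\<^sup>3/12\<close>.
\<close>

lemma cell_mean_bound:
  assumes n: "n \<ge> 2" and e: "H10_graph e w" and zero: "\<And>i. i \<in> {1..n} \<Longrightarrow> incr n w i = 0"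
    and i: "i \<in> {1..n}"
  shows "(leb_int (node n (i - 1)) (node n i) e)\<^sup>2
    \<le> (mesh_size n)^3 / 12 * leb_int (node n (i - 1)) (node n i) (\<lambda>x. (w x)\<^sup>2)"
proof -
  define h where "h = mesh_size n"
  define a where "a = node n (i - 1)"
  define b where "b = node n i"
  define m where "m = (a + b) / 2"
  have ab: "0 \<le> a" "a \<le> b" "b \<le> 1" "b = a + h"
    using i node_le_1[OF n, of i] node_pred[of i n] node_nonneg[of n "i - 1"] node_mono[of "i - 1" i n]
    by (auto simp: a_def b_def h_def)
  have w: "w \<in> L2" using e by (simp add: H10_graph_def)
  have lin: "(\<lambda>x. c - x) \<in> L2" for c by (intro L2_continuous continuous_intros)
  have wi: "integrable (lebesgue_on {a..b}) w" by (intro L2_integrable_subinterval w ab)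
  have lwi: "integrable (lebesgue_on {a..b}) (\<lambda>x. (c - x) * w x)" for c
    using integrable_subinterval[OF integrable_mult_L2[OF lin[of c] w], of a b] ab by simp
  have "leb_int 0 a w = (\<Sum>k=1..i-1. incr n w k)"
    unfolding a_def incr_def using i by (intro leb_int_partition L2_integrable w n) auto
  also have "\<dots> = 0" using zero i by (intro sum.neutral) auto
  finally have "leb_int a b e = leb_int a b (\<lambda>x. (b - x) * w x)"
    using H10_graph_integral[OF e ab(1-3)] by simp
  also have "\<dots> = leb_int a b (\<lambda>x. (m - x) * w x + (b - m) * w x)"
    by (rule leb_int_cong) (simp add: algebra_simps)
  also have "\<dots> = leb_int a b (\<lambda>x. (m - x) * w x) + (b - m) * leb_int a b w"
    using wi lwi by (simp add: leb_int_def)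
  also have "leb_int a b w = 0" using zero[OF i] by (simp add: incr_def a_def b_def)
  finally have "leb_int a b e = leb_int a b (\<lambda>x. (m - x) * w x)" by simp
  then have "(leb_int a b e)\<^sup>2 \<le> leb_int a b (\<lambda>x. (m - x)\<^sup>2) * leb_int a b (\<lambda>x. (w x)\<^sup>2)"
    using integral_Cauchy_Schwarz[of "lebesgue_on {a..b}" "\<lambda>x. m - x" w] lwi
      integrable_subinterval[OF L2D(2)[OF w], of a b] integrable_subinterval[OF L2D(2)[OF lin], of a b m] ab
    by (simp add: leb_int_def)
  also have "leb_int a b (\<lambda>x. (m - x)\<^sup>2) = - ((m - b)^3 / 3) - (- ((m - a)^3 / 3))"
  proof (rule leb_int_FTC[where S = "{}"])
    show "((\<lambda>x. - ((m - x)^3 / 3)) has_real_derivative (m - x)\<^sup>2) (at x)" for x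
      by (auto intro!: derivative_eq_intros simp: power2_eq_square)
    show "integrable (lebesgue_on {a..b}) (\<lambda>x. (m - x)\<^sup>2)"
      by (intro continuous_imp_integrable_real continuous_intros)
  qed (use ab in \<open>auto intro!: continuous_intros\<close>)
  also have "- ((m - b)^3 / 3) - (- ((m - a)^3 / 3)) = h^3 / 12"
    using ab(4) by (simp add: m_def power3_eq_cube field_simps)
  finally show ?thesis by (simp add: a_def b_def h_def)
qed

lemma star_seminorm_sq_bound:
  assumes n: "n \<ge> 2" and e: "H10_graph e w" and zero: "\<And>i. i \<in> {1..n} \<Longrightarrow> incr n w i = 0"
  shows "star_seminorm_sq n e \<le> (mesh_size n)\<^sup>2 / 12 * H10_norm_sq e"
proof -
  define h where "h = mesh_size n"
  have h: "h > 0" "1 / real n = h" using mesh_size_pos[OF n] by (simp_all add: h_def mesh_size_def)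
  let ?m = "\<lambda>i. leb_int (node n (i - 1)) (node n i) e"
  let ?E = "\<lambda>i. leb_int (node n (i - 1)) (node n i) (\<lambda>x. (w x)\<^sup>2)"
  have w: "w \<in> L2" using e by (simp add: H10_graph_def)
  have "star_seminorm_sq n e \<le> h * (\<Sum>i=1..n. (1 / h * ?m i)\<^sup>2)"
    by (simp add: star_seminorm_sq_def h_def[symmetric] h(2)[symmetric])
  also have "\<dots> \<le> h * (\<Sum>i=1..n. h / 12 * ?E i)"
  proof (intro mult_left_mono sum_mono)
    fix i assume i: "i \<in> {1..n}"
    have "(1 / h * ?m i)\<^sup>2 = (?m i)\<^sup>2 / h\<^sup>2" by (simp add: power_divide)
    also have "\<dots> \<le> (h^3 / 12 * ?E i) / h\<^sup>2"
      using cell_mean_bound[OF n e zero i] by (intro divide_right_mono) (auto simp: h_def)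
    also have "\<dots> = h / 12 * ?E i" using h by (simp add: power3_eq_cube power2_eq_square)
    finally show "(1 / h * ?m i)\<^sup>2 \<le> h / 12 * ?E i" .
  qed (use h in auto)
  also have "\<dots> = h\<^sup>2 / 12 * (\<Sum>i=1..n. ?E i)"
    unfolding sum_distrib_left[symmetric] by (simp add: power2_eq_square)
  also have "(\<Sum>i=1..n. ?E i) = H10_norm_sq e"
    using leb_int_partition[OF L2D(2)[OF w] n, of n] by (simp add: H10_norm_sq_graph[OF e] node_n[OF n])
  finally show ?thesis by (simp add: h_def)
qed

section \<open>The error estimate\<close>

text \<open>The difference of both sides vanishes at \<open>0\<close> and has the derivative \<open>tanh\<^sup>4\<close>.\<close>

lemma tanh_cubic_le:
  fixes t :: real
  assumes "t \<ge> 0" shows "tanh t + tanh t ^ 3 / 3 \<le> t"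
proof -
  have "(\<lambda>s. s - (tanh s + tanh s ^ 3 / 3)) 0 \<le> (\<lambda>s. s - (tanh s + tanh s ^ 3 / 3)) t"
  proof (rule DERIV_nonneg_imp_nondecreasing[OF assms])
    fix x :: real
    have "((\<lambda>s. s - (tanh s + tanh s ^ 3 / 3)) has_real_derivative tanh x ^ 4) (at x)"
      by (rule derivative_eq_intros refl | simp add: field_simps eval_nat_numeral)+
    then show "\<exists>y. ((\<lambda>s. s - (tanh s + tanh s ^ 3 / 3)) has_real_derivative y) (at x) \<and> 0 \<le> y"
      by (intro exI[of _ "tanh x ^ 4"]) simp
  qed
  then show ?thesis by simp
qed

definition scaled_norm_sq :: "real \<Rightarrow> nat \<Rightarrow> (real \<Rightarrow> real) \<Rightarrow> real" where
  "scaled_norm_sq \<epsilon> n u = (mesh_size n)\<^sup>2 * H10_norm_sq u + 4 * (g0 \<epsilon> n)\<^sup>2 * star_seminorm_sq n u"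

lemma star_norm_scaled:
  assumes "\<epsilon> > 0" "n \<ge> 2"
  shows "star_norm \<epsilon> n u = sqrt (\<epsilon> / (2 * g0 \<epsilon> n * mesh_size n) * scaled_norm_sq \<epsilon> n u)"
proof -
  have "g0 \<epsilon> n > 0" "mesh_size n > 0" using assms by (auto intro: g0_bounds mesh_size_pos)
  then have "2 * g0 \<epsilon> n * (\<epsilon> / mesh_size n) *
      ((mesh_size n)\<^sup>2 / (4 * (g0 \<epsilon> n)\<^sup>2) * H10_norm_sq u + star_seminorm_sq n u)
    = \<epsilon> / (2 * g0 \<epsilon> n * mesh_size n) * scaled_norm_sq \<epsilon> n u"
    by (simp add: scaled_norm_sq_def field_simps power2_eq_square)
  then show ?thesis by (simp add: star_norm_def)
qed

text \<open>
  The factor \<open>1 + g\<^sup>2/3\<close> collects the energy and the cell means of the error, both bounded by its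
  energy, which in turn is at most the energy of \<open>u - p\<close>.
\<close>

lemma error_bound:
  assumes \<epsilon>: "\<epsilon> > 0" and n: "n \<ge> 2" and u: "u \<in> H10"
    and gal: "\<forall>v\<in>H10. bform \<epsilon> v u = L2_inner f v"
      "\<forall>v\<in>test_space \<epsilon> n. bform \<epsilon> v u\<^sub>h = L2_inner f v"
    and uh: "u\<^sub>h \<in> trial_space n" and p: "p \<in> trial_space n"
  shows "scaled_norm_sq \<epsilon> n (\<lambda>x. u x - u\<^sub>h x)
    \<le> mesh_size n / (2 * \<epsilon>) * (1 / g0 \<epsilon> n) * scaled_norm_sq \<epsilon> n (\<lambda>x. u x - p x)"
proof -
  define h where "h = mesh_size n"
  define g where "g = g0 \<epsilon> n"
  define t where "t = h / (2 * \<epsilon>)"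
  define C where "C = t * (1 / g)"
  have h: "h > 0" using mesh_size_pos[OF n] by (simp add: h_def)
  have g: "0 < g" using g0_bounds[OF \<epsilon> n] by (simp add: g_def)
  have gt: "g = tanh t" by (simp add: g_def g0_def t_def h_def)
  have t: "t > 0" using h \<epsilon> by (simp add: t_def)
  obtain c where c: "u\<^sub>h = (\<lambda>x. \<Sum>j=1..n-1. c j * hat n j x)" using uh by (auto simp: trial_space_def)
  obtain d where d: "p = (\<lambda>x. \<Sum>j=1..n-1. d j * hat n j x)" using p by (auto simp: trial_space_def)
  define w where "w = wderiv u"
  define r where "r = (\<lambda>x. \<Sum>j=1..n-1. c j * hat_deriv n j x)"
  have uw: "H10_graph u w" unfolding w_def by (rule H10_graph_wderiv[OF u])
  have uhr: "H10_graph u\<^sub>h r" unfolding c r_def by (rule H10_graph_trial[OF n])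
  define e where "e = (\<lambda>x. u x - u\<^sub>h x)"
  have eg: "H10_graph e (\<lambda>x. w x - r x)"
    using H10_graph_lincomb[OF uw uhr, of "-1"] by (simp add: e_def)
  have zero: "incr n (\<lambda>x. w x - r x) i = 0" if "i \<in> {1..n}" for i
    by (rule Petrov_Galerkin_error_increments[OF \<epsilon> n uw uhr gal that])
  have "(\<lambda>x. u\<^sub>h x - p x) \<in> trial_space n"
    unfolding trial_space_def c d
    by (intro CollectI exI[of _ "\<lambda>j. c j - d j"]) (simp add: left_diff_distrib sum_subtractf)
  from error_energy_minimal[OF n eg zero this]
  have mini: "H10_norm_sq e \<le> H10_norm_sq (\<lambda>x. u x - p x)" by (simp add: e_def)
  have "u \<in> L2" "p \<in> L2"
    using uw H10_graph_trial[OF n, of d] by (auto simp: H10_graph_def d)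
  then have star: "0 \<le> star_seminorm_sq n (\<lambda>x. u x - p x)"
    by (intro star_seminorm_sq_nonneg[OF n] L2_diff)
  have gC: "1 + g\<^sup>2 / 3 \<le> C"
    using tanh_cubic_le[of t] t g
    by (simp add: C_def gt[symmetric] pos_le_divide_eq algebra_simps power2_eq_square power3_eq_cube)
  have N0: "0 \<le> H10_norm_sq e" by (simp add: H10_norm_sq_def leb_int_square_nonneg)
  have C0: "C \<ge> 0" using t g by (simp add: C_def)
  have "scaled_norm_sq \<epsilon> n e \<le> h\<^sup>2 * H10_norm_sq e + 4 * g\<^sup>2 * (h\<^sup>2 / 12 * H10_norm_sq e)"
    unfolding scaled_norm_sq_def h_def[symmetric] g_def[symmetric]
    by (intro add_left_mono mult_left_mono star_seminorm_sq_bound[OF n eg zero, folded h_def]) auto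
  also have "\<dots> = (1 + g\<^sup>2 / 3) * (h\<^sup>2 * H10_norm_sq e)" by (simp add: algebra_simps)
  also have "\<dots> \<le> C * (h\<^sup>2 * H10_norm_sq e)" using gC N0 by (intro mult_right_mono) auto
  also have "\<dots> \<le> C * (h\<^sup>2 * H10_norm_sq (\<lambda>x. u x - p x))"
    using mini C0 by (intro mult_left_mono) auto
  also have "\<dots> \<le> C * scaled_norm_sq \<epsilon> n (\<lambda>x. u x - p x)"
    using star C0 by (intro mult_left_mono) (auto simp: scaled_norm_sq_def h_def)
  finally show ?thesis by (simp add: e_def C_def t_def h_def g_def)
qed

theorem theorem6p3:
  fixes \<epsilon> :: real and n :: nat and f u u\<^sub>h :: "real \<Rightarrow> real"
  assumes "\<epsilon> > 0" and "n \<ge> 2"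
    and "continuous_on {0..1} f"
    and "u \<in> H10"
    and "\<forall>v\<in>H10. bform \<epsilon> v u = L2_inner f v"
    and "u\<^sub>h \<in> trial_space n"
    and "\<forall>v\<^sub>h\<in>test_space \<epsilon> n. bform \<epsilon> v\<^sub>h u\<^sub>h = L2_inner f v\<^sub>h"
  shows "star_norm \<epsilon> n (\<lambda>x. u x - u\<^sub>h x)
           \<le> sqrt (mesh_size n / (2 * \<epsilon>) * (1 / g0 \<epsilon> n)) *
             (INF p\<^sub>h\<in>trial_space n. star_norm \<epsilon> n (\<lambda>x. u x - p\<^sub>h x))
         \<and> (mesh_size n)\<^sup>2 * H10_norm_sq (\<lambda>x. u x - u\<^sub>h x)
             + 4 * (g0 \<epsilon> n)\<^sup>2 * star_seminorm_sq n (\<lambda>x. u x - u\<^sub>h x)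
           \<le> mesh_size n / (2 * \<epsilon>) * (1 / g0 \<epsilon> n) *
             (INF p\<^sub>h\<in>trial_space n.
                (mesh_size n)\<^sup>2 * H10_norm_sq (\<lambda>x. u x - p\<^sub>h x)
                + 4 * (g0 \<epsilon> n)\<^sup>2 * star_seminorm_sq n (\<lambda>x. u x - p\<^sub>h x))"
proof -
  define C where "C = mesh_size n / (2 * \<epsilon>) * (1 / g0 \<epsilon> n)"
  define s where "s = \<epsilon> / (2 * g0 \<epsilon> n * mesh_size n)"
  have pos: "g0 \<epsilon> n > 0" "mesh_size n > 0" using assms(1,2) by (auto intro: g0_bounds mesh_size_pos)
  then have C: "C > 0" and s: "s > 0" using assms(1) by (auto simp: C_def s_def)
  \<comment> \<open>The infimum is taken over a nonempty set, because \<open>u\<^sub>h\<close> belongs to the trial space.\<close>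
  have INF_I: "X \<le> k * (INF p\<in>trial_space n. F p)"
    if "k > 0" "\<And>p. p \<in> trial_space n \<Longrightarrow> X \<le> k * F p" for X k and F :: "(real \<Rightarrow> real) \<Rightarrow> real"
  proof -
    have "X / k \<le> (INF p\<in>trial_space n. F p)"
      using that assms(6) by (intro cINF_greatest) (auto simp: pos_divide_le_eq mult.commute)
    then show ?thesis using that(1) by (simp add: pos_divide_le_eq mult.commute)
  qed
  have bound: "scaled_norm_sq \<epsilon> n (\<lambda>x. u x - u\<^sub>h x) \<le> C * scaled_norm_sq \<epsilon> n (\<lambda>x. u x - p x)"
    if "p \<in> trial_space n" for p
    unfolding C_def by (rule error_bound[OF assms(1,2,4,5,7,6) that])
  have "star_norm \<epsilon> n (\<lambda>x. u x - u\<^sub>h x) \<le> sqrt C * star_norm \<epsilon> n (\<lambda>x. u x - p x)"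
    if "p \<in> trial_space n" for p
  proof -
    have "s * scaled_norm_sq \<epsilon> n (\<lambda>x. u x - u\<^sub>h x) \<le> C * (s * scaled_norm_sq \<epsilon> n (\<lambda>x. u x - p x))"
      using mult_left_mono[OF bound[OF that], of s] s by (simp add: mult.left_commute)
    then show ?thesis
      unfolding star_norm_scaled[OF assms(1,2)] s_def[symmetric] real_sqrt_mult[of C, symmetric]
      by (rule real_sqrt_le_mono)
  qed
  then have "star_norm \<epsilon> n (\<lambda>x. u x - u\<^sub>h x)
      \<le> sqrt C * (INF p\<in>trial_space n. star_norm \<epsilon> n (\<lambda>x. u x - p x))"
    using C by (intro INF_I) auto
  moreover have "scaled_norm_sq \<epsilon> n (\<lambda>x. u x - u\<^sub>h x)
      \<le> C * (INF p\<in>trial_space n. scaled_norm_sq \<epsilon> n (\<lambda>x. u x - p x))"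
    using C bound by (intro INF_I) auto
  ultimately show ?thesis unfolding C_def scaled_norm_sq_def by (rule conjI)
qed

end
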